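(* Let $\Phi=\{\phi_i\}_{i\in\mathcal{D}}$ be a conformal iterated function system satisfying the open set condition, with attractor $X\subset\mathbb{R}^d$, and let $z\in X$. Suppose $\theta:\mathbb{N}\to\mathbb{R}_{\geq 0}$ satisfies $\theta(n)\asymp n^{-1/\dim_{H}(X)}$. Then $\mathcal{H}^{\dim_{H}(X)}$-almost every $x\in X$ is an element of $W(\theta,z)$.
   Context: An iterated function system (IFS) is a finite set of contractions $\Phi=\{\phi_i\}_{i\in\mathcal{D}}$ of a closed set $Y\subset\mathbb{R}^d$ into itself; its attractor is the unique non-empty compact set $X$ with $X=\bigcup_{i\in\mathcal{D}}\phi_i(X)$. It is implicit that $\dim_H(X)>0$. Write $\mathcal{D}^n$ for words of length $n$ over $\mathcal{D}$, $\mathcal{D}^*=\bigcup_{n\ge1}\mathcal{D}^n$; for $I=(i_1,\dots,i_n)$, $|I|=n$, $\phi_I=\phi_{i_1}\circ\cdots\circ\phi_{i_n}$, $X_I=\phi_I(X)$. $\dim_H$ and $\mathcal{H}^s$ denote Hausdorff dimension and $s$-dimensional Hausdorff measure, $Diam$ denotes diameter, $B(x,r)$ is the closed Euclidean ball of centre $x$ and radius $r$. $f\asymp g$ means there is $C>0$ with $C^{-1}f\le g\le Cf$ everywhere. Conformal IFS: an IFS $\Phi$ on a compact set $Y\subset\mathbb{R}^d$ such that each $\phi_i$ extends to an injective conformal contraction on some open connected neighbourhood $V$ of $Y$ (conformal: $C^1$ with $|\phi_i'(x)y|=|\phi_i'(x)||y|$ for all $x\in V$, $y\in\mathbb{R}^d$),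 with $0<\inf_{x\in V}|\phi_i'(x)|\le\sup_{x\in V}|\phi_i'(x)|<1$, and such that for some $\alpha,c>0$, $||\phi_i'(x)|-|\phi_i'(y)||\le c|x-y|^\alpha$ for all $x,y\in V$, $i\in\mathcal{D}$. Open set condition: there is a non-empty open set $O\subset\mathbb{R}^d$ (in the domain of the maps) with $\phi_i(O)\subset O$ for all $i\in\mathcal{D}$ and $\phi_i(O)\cap\phi_j(O)=\emptyset$ for all $i\ne j$. For $z\in X$ and $\theta:\mathbb{N}\to\mathbb{R}_{\ge0}$, $$W(\theta,z):=\{x\in X: x\in B(\phi_I(z),Diam(X_I)\theta(|I|))\text{ for infinitely many } I\in\mathcal{D}^*\}.$$ *)

theory Defs
  imports "HOL-Analysis.Analysis"
begin

section \<open>Hausdorff measure and dimension\<close>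

text \<open>The weight \<open>diameter U ^ s\<close> of a covering set, with the convention \<open>0 ^ 0 = 1\<close> for non-empty
  sets (Isabelle's \<open>0 powr 0\<close> is \<open>0\<close>), so that the case \<open>s = 0\<close> yields counting measure.\<close>

definition hausdorff_weight :: "real \<Rightarrow> 'a::euclidean_space set \<Rightarrow> ennreal" where
  "hausdorff_weight s U =
     (if U = {} then 0 else if s = 0 then 1 else ennreal (diameter U powr s))"

text \<open>Boundedness of the covering sets is required explicitly because \<open>diameter\<close> is unspecified on
  unbounded sets. Finite covers are included, since the \<open>U n\<close> may be empty.\<close>

definition hausdorff_premeasure :: "real \<Rightarrow> real \<Rightarrow> 'a::euclidean_space set \<Rightarrow> ennreal" where
  "hausdorff_premeasure s \<delta> A =
     (INF U \<in> {U :: nat \<Rightarrow> 'a set. A \<subseteq> (\<Union>n. U n) \<and> (\<forall>n. bounded (U n) \<and> diameter (U n) \<le> \<delta>)}.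
        \<Sum>n. hausdorff_weight s (U n))"

text \<open>This is the outer measure, defined on all sets.\<close>

definition hausdorff_measure :: "real \<Rightarrow> 'a::euclidean_space set \<Rightarrow> ennreal" where
  "hausdorff_measure s A = (SUP \<delta> \<in> {0<..}. hausdorff_premeasure s \<delta> A)"

text \<open>In a Euclidean space the set below contains every \<open>s > DIM('a)\<close>, so the infimum in the reals
  is the genuine one.\<close>

definition hausdorff_dim :: "'a::euclidean_space set \<Rightarrow> real" where
  "hausdorff_dim A = Inf {s. 0 \<le> s \<and> hausdorff_measure s A = 0}"


section \<open>Conformal iterated function systems\<close>

definition contraction_on :: "'a::euclidean_space set \<Rightarrow> ('a \<Rightarrow> 'a) \<Rightarrow> bool" where
  "contraction_on S f \<longleftrightarrow> (\<exists>r<1. r-lipschitz_on S f)"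

definition ifs :: "'i set \<Rightarrow> ('i \<Rightarrow> 'a::euclidean_space \<Rightarrow> 'a) \<Rightarrow> 'a set \<Rightarrow> bool" where
  "ifs D \<phi> Y \<longleftrightarrow>
     finite D \<and> closed Y \<and> (\<forall>i\<in>D. \<phi> i ` Y \<subseteq> Y \<and> contraction_on Y (\<phi> i))"

definition is_attractor ::
    "'i set \<Rightarrow> ('i \<Rightarrow> 'a::euclidean_space \<Rightarrow> 'a) \<Rightarrow> 'a set \<Rightarrow> 'a set \<Rightarrow> bool" where
  "is_attractor D \<phi> Y X \<longleftrightarrow>
     X \<subseteq> Y \<and> X \<noteq> {} \<and> compact X \<and> X = (\<Union>i\<in>D. \<phi> i ` X)"

definition conformal_on ::
    "'a::euclidean_space set \<Rightarrow> ('a \<Rightarrow> 'a) \<Rightarrow> ('a \<Rightarrow> 'a \<Rightarrow>\<^sub>L 'a) \<Rightarrow> bool" where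
  "conformal_on V f f' \<longleftrightarrow>
     (\<forall>x\<in>V. (f has_derivative blinfun_apply (f' x)) (at x)) \<and>
     continuous_on V f' \<and>
     (\<forall>x\<in>V. \<forall>y. norm (blinfun_apply (f' x) y) = norm (f' x) * norm y)"

text \<open>The total functions \<open>\<phi> i\<close> play the role of the extensions to the common open neighbourhood \<open>V\<close>;
  the maps of the system are their restrictions to \<open>Y\<close>. The extensions are not required to map \<open>V\<close>
  into itself. The supremum below is over a bounded set, since \<open>\<phi> i\<close> is Lipschitz on the
  open set \<open>V\<close>.\<close>

definition conformal_ifs ::
    "'i set \<Rightarrow> ('i \<Rightarrow> 'a::euclidean_space \<Rightarrow> 'a) \<Rightarrow> 'a set \<Rightarrow> 'a set \<Rightarrow> bool" where
  "conformal_ifs D \<phi> Y V \<longleftrightarrow>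
     ifs D \<phi> Y \<and> compact Y \<and> open V \<and> connected V \<and> Y \<subseteq> V \<and>
     (\<exists>\<phi>'.
        (\<forall>i\<in>D. inj_on (\<phi> i) V \<and> contraction_on V (\<phi> i) \<and> conformal_on V (\<phi> i) (\<phi>' i) \<and>
                0 < (INF x\<in>V. norm (\<phi>' i x)) \<and> (SUP x\<in>V. norm (\<phi>' i x)) < 1) \<and>
        (\<exists>\<alpha>>0. \<exists>c>0. \<forall>i\<in>D. \<forall>x\<in>V. \<forall>y\<in>V.
           \<bar>norm (\<phi>' i x) - norm (\<phi>' i y)\<bar> \<le> c * norm (x - y) powr \<alpha>))"

definition open_set_condition ::
    "'i set \<Rightarrow> ('i \<Rightarrow> 'a::euclidean_space \<Rightarrow> 'a) \<Rightarrow> 'a set \<Rightarrow> bool" where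
  "open_set_condition D \<phi> V \<longleftrightarrow>
     (\<exists>U. open U \<and> U \<noteq> {} \<and> U \<subseteq> V \<and> (\<forall>i\<in>D. \<phi> i ` U \<subseteq> U) \<and>
          (\<forall>i\<in>D. \<forall>j\<in>D. i \<noteq> j \<longrightarrow> \<phi> i ` U \<inter> \<phi> j ` U = {}))"


section \<open>The limsup set\<close>

text \<open>Words are lists; \<open>foldr \<phi> [i\<^sub>1, \<dots>, i\<^sub>n] = \<phi> i\<^sub>1 \<circ> \<dots> \<circ> \<phi> i\<^sub>n\<close>.\<close>

abbreviation word_map :: "('i \<Rightarrow> 'a \<Rightarrow> 'a) \<Rightarrow> 'i list \<Rightarrow> 'a \<Rightarrow> 'a" where
  "word_map \<phi> I \<equiv> foldr \<phi> I"

definition limsup_set ::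
    "'i set \<Rightarrow> ('i \<Rightarrow> 'a::euclidean_space \<Rightarrow> 'a) \<Rightarrow> 'a set \<Rightarrow> (nat \<Rightarrow> real) \<Rightarrow> 'a \<Rightarrow> 'a set" where
  "limsup_set D \<phi> X \<theta> z =
     {x \<in> X. infinite {I \<in> lists D. I \<noteq> [] \<and>
        x \<in> cball (word_map \<phi> I z) (diameter (word_map \<phi> I ` X) * \<theta> (length I))}}"

text \<open>Two-sided comparability at every point of \<open>A\<close>, not merely eventually.\<close>

definition comparable_on :: "'b set \<Rightarrow> ('b \<Rightarrow> real) \<Rightarrow> ('b \<Rightarrow> real) \<Rightarrow> bool" where
  "comparable_on A f g \<longleftrightarrow> (\<exists>C>0. \<forall>x\<in>A. inverse C * f x \<le> g x \<and> g x \<le> C * f x)"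

end

theory Submission
  imports Defs "HOL-Library.Sublist"
begin

text \<open>
  Let \<open>s\<close> be the dimension of the attractor and let a word \<open>I\<close> have weight \<open>\<Lambda> I\<close>, the
  norm of the derivative of its map at a base point of \<open>X\<close>.

  \<^emph>\<open>Reduction to words.\<close> Bounded distortion makes \<open>\<Lambda>\<close> multiplicative up to a constant and
  comparable with the diameters of the cylinders. Given \<open>n\<close>, let \<open>J\<^sub>n\<close> be a word coding an initial
  segment of \<open>z\<close>, stopped when its weight drops below a small multiple of \<open>n\<close> to the power \<open>-1/s\<close>.
  If \<open>x\<close> has a coding that starts with \<open>I J\<^sub>n\<close>, where \<open>I\<close> has length \<open>n\<close>, then \<open>x\<close> and \<open>\<phi>\<^sub>I(z)\<close> lie in the
  same cylinder of \<open>I J\<^sub>n\<close>, whose diameter is at most \<open>Diam(X\<^sub>I) \<theta>(n)\<close>. So \<open>x\<close> is in the limsup set as soon as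
  its coding shows \<open>J\<^sub>n\<close> at position \<open>n\<close> for infinitely many \<open>n\<close>.

  \<^emph>\<open>A product that tends to zero.\<close> The word \<open>J\<^sub>n\<close> has length at most a constant times \<open>ln n\<close>
  and its weight satisfies \<open>\<Lambda>(J\<^sub>n)\<^sup>s \<ge> c / n\<close>. Test only the positions \<open>n\<^sub>0, n\<^sub>1, \<dots>\<close> with
  \<open>n\<^sub>t\<^sub>+\<^sub>1 = n\<^sub>t + |J|\<close> for the word \<open>J\<close> tested at \<open>n\<^sub>t\<close>. The tested blocks are then disjoint, so each test removes
  at least a constant multiple of \<open>1 / n\<^sub>t\<close> of the mass that is left, whatever has happened before (lemma
  \<open>survivors_mass_le\<close>). The positions grow so slowly that the sum of the \<open>1 / n\<^sub>t\<close> still diverges,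
  because \<open>ln (ln n\<^sub>t)\<close> increases by at most a constant times \<open>1 / n\<^sub>t\<close> (lemma
  \<open>sum_inverse_unbounded_if_log_steps\<close>). Hence the points missing all targets beyond
  a given level are covered by cylinders with \<open>\<Sum> \<Lambda>\<^sup>s\<close> arbitrarily small, which makes them a null set.
  Since the remaining mass tends to \<open>0\<close> along the product, almost every point is hit without any appeal to
  ergodicity.

  \<^emph>\<open>Pressure at the dimension.\<close> For the proportions above the sums \<open>S\<^sub>n = \<Sum> \<Lambda>(I)\<^sup>s\<close> over the words of
  length \<open>n\<close> must be bounded above and away from \<open>0\<close>. If they are not bounded away from \<open>0\<close>, then the cylinders of some
  level show that \<open>X\<close> itself is null and there is nothing left to prove. If they exceeded the
  multiplicativity constant, they would do so for an exponent \<open>t > s\<close> as well and stay bounded below for that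
  \<open>t\<close>; the mass distribution principle, in the form of lemma
  \<open>positive_measure_if_pressure_sum_ge\<close>, would give \<open>X\<close> positive \<open>t\<close>-dimensional measure. This is where the
  open set condition enters: by a volume count, a ball of radius \<open>d\<close> meets boundedly many
  cylinders of size about \<open>d\<close>.
\<close>

section \<open>Null sets of Hausdorff measures\<close>

text \<open>
  For \<open>s > 0\<close> the diameters of a cover take care of themselves: a term that is at most \<open>\<delta>\<^sup>s\<close> comes
  from a set of diameter at most \<open>\<delta>\<close>. Small total weight is therefore all that has to be checked.
\<close>

lemma hausdorff_null_if_small_covers:
  fixes A :: "'a::euclidean_space set"
  assumes s: "s > 0"
    and cov: "\<And>e. e > 0 \<Longrightarrow> \<exists>U::nat \<Rightarrow> 'a set. A \<subseteq> (\<Union>n. U n) \<and> (\<forall>n. bounded (U n)) \<and>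
      (\<Sum>n. hausdorff_weight s (U n)) \<le> ennreal e"
  shows "hausdorff_measure s A = 0"
proof -
  have "hausdorff_premeasure s \<delta> A = 0" if \<delta>: "\<delta> > 0" for \<delta>
  proof -
    have "hausdorff_premeasure s \<delta> A \<le> 0 + ennreal e" if e: "e > 0" for e
    proof -
      have "min e (\<delta> powr s) > 0" using e \<delta> by simp
      from cov[OF this] obtain U :: "nat \<Rightarrow> 'a set" where U: "A \<subseteq> (\<Union>n. U n)" "\<And>n. bounded (U n)"
        and sm: "(\<Sum>n. hausdorff_weight s (U n)) \<le> ennreal (min e (\<delta> powr s))" by blast
      have "diameter (U n) \<le> \<delta>" for n
      proof (cases "U n = {}")
        case False
        have "hausdorff_weight s (U n) \<le> (\<Sum>n. hausdorff_weight s (U n))"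
          using sum_le_suminf[of "\<lambda>n. hausdorff_weight s (U n)" "{n}"] by simp
        also have "\<dots> \<le> ennreal (\<delta> powr s)"
          using sm by (rule order_trans) (simp add: ennreal_leI)
        finally have "diameter (U n) powr s \<le> \<delta> powr s"
          using False s by (simp add: hausdorff_weight_def)
        then show ?thesis
          using powr_less_mono2[OF s, of \<delta> "diameter (U n)"] \<delta> by force
      qed (use \<delta> in auto)
      then have "hausdorff_premeasure s \<delta> A \<le> (\<Sum>n. hausdorff_weight s (U n))"
        unfolding hausdorff_premeasure_def using U by (intro INF_lower) auto
      also have "\<dots> \<le> ennreal e"
        using sm by (rule order_trans) (simp add: ennreal_leI)
      finally show ?thesis by simp
    qed
    then have "hausdorff_premeasure s \<delta> A \<le> 0"
      using ennreal_le_epsilon[of 0 "hausdorff_premeasure s \<delta> A"] by blast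
    then show ?thesis by simp
  qed
  then show ?thesis
    unfolding hausdorff_measure_def by (auto simp: SUP_eq_iff intro!: SUP_eq_const)
qed

lemma hausdorff_null_small_cover:
  fixes A :: "'a::euclidean_space set"
  assumes "hausdorff_measure s A = 0" "e > 0"
  obtains U :: "nat \<Rightarrow> 'a set" where "A \<subseteq> (\<Union>n. U n)" "\<forall>n. bounded (U n)" "\<forall>n. diameter (U n) \<le> 1"
    "(\<Sum>n. hausdorff_weight s (U n)) < ennreal e"
proof -
  have "hausdorff_premeasure s 1 A \<le> hausdorff_measure s A"
    unfolding hausdorff_measure_def by (intro SUP_upper) auto
  then have "hausdorff_premeasure s 1 A < ennreal e"
    using assms by simp
  then obtain U where "U \<in> {U :: nat \<Rightarrow> 'a set. A \<subseteq> (\<Union>n. U n) \<and> (\<forall>n. bounded (U n) \<and> diameter (U n) \<le> 1)}"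
    "(\<Sum>n. hausdorff_weight s (U n)) < ennreal e"
    unfolding hausdorff_premeasure_def INF_less_iff by (elim bexE)
  then show thesis by (intro that[of U]) auto
qed

lemma hausdorff_null_mono_exponent:
  fixes A :: "'a::euclidean_space set"
  assumes null: "hausdorff_measure u A = 0" and u: "0 \<le> u" "u < t"
  shows "hausdorff_measure t A = 0"
proof (rule hausdorff_null_if_small_covers)
  fix e :: real assume e: "e > 0"
  obtain U :: "nat \<Rightarrow> 'a set" where U: "A \<subseteq> (\<Union>n. U n)" "\<forall>n. bounded (U n)" "\<forall>n. diameter (U n) \<le> 1"
    "(\<Sum>n. hausdorff_weight u (U n)) < ennreal e"
    by (rule hausdorff_null_small_cover[OF null e])
  have "hausdorff_weight t (U n) \<le> hausdorff_weight u (U n)" for n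
  proof -
    have d: "0 \<le> diameter (U n)" using U(2) by (simp add: diameter_ge_0)
    have "diameter (U n) powr t \<le> 1"
      using powr_le1[of t "diameter (U n)"] u d U(3) by auto
    moreover have "diameter (U n) powr t \<le> diameter (U n) powr u"
      using powr_mono'[of u t "diameter (U n)"] u d U(3) by auto
    ultimately show ?thesis
      using u by (auto simp: hausdorff_weight_def ennreal_leI)
  qed
  then have "(\<Sum>n. hausdorff_weight t (U n)) \<le> (\<Sum>n. hausdorff_weight u (U n))"
    by (intro suminf_le) auto
  also note U(4)
  finally have "(\<Sum>n. hausdorff_weight t (U n)) \<le> ennreal e" by simp
  then show "\<exists>U::nat \<Rightarrow> 'a set. A \<subseteq> (\<Union>n. U n) \<and> (\<forall>n. bounded (U n)) \<and>
      (\<Sum>n. hausdorff_weight t (U n)) \<le> ennreal e"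
    using U(1,2) by blast
qed (use u in auto)

lemma hausdorff_null_UN:
  fixes A :: "nat \<Rightarrow> 'a::euclidean_space set"
  assumes s: "s > 0" and null: "\<And>k. hausdorff_measure s (A k) = 0"
  shows "hausdorff_measure s (\<Union>k. A k) = 0"
proof (rule hausdorff_null_if_small_covers[OF s])
  fix e :: real assume e: "e > 0"
  have "\<exists>U::nat \<Rightarrow> 'a set. A k \<subseteq> (\<Union>n. U n) \<and> (\<forall>n. bounded (U n)) \<and>
      (\<Sum>n. hausdorff_weight s (U n)) < ennreal (e * (1/2) ^ Suc k)" for k
  proof -
    have "e * (1/2) ^ Suc k > 0" using e by simp
    then obtain U :: "nat \<Rightarrow> 'a set" where "A k \<subseteq> (\<Union>n. U n)" "\<forall>n. bounded (U n)" "\<forall>n. diameter (U n) \<le> 1"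
      "(\<Sum>n. hausdorff_weight s (U n)) < ennreal (e * (1/2) ^ Suc k)"
      by (rule hausdorff_null_small_cover[OF null])
    then show ?thesis by (intro exI[of _ U] conjI)
  qed
  then obtain U :: "nat \<Rightarrow> nat \<Rightarrow> 'a set" where U: "\<And>k. A k \<subseteq> (\<Union>n. U k n)"
    "\<And>k n. bounded (U k n)"
    "\<And>k. (\<Sum>n. hausdorff_weight s (U k n)) < ennreal (e * (1/2) ^ Suc k)"
    by metis
  define W where "W m = (case prod_decode m of (k, n) \<Rightarrow> U k n)" for m
  have "(\<Union>k. A k) \<subseteq> (\<Union>m. W m)"
  proof
    fix x assume "x \<in> (\<Union>k. A k)"
    then obtain k n where "x \<in> U k n" using U(1) by blast
    then have "x \<in> W (prod_encode (k, n))" by (simp add: W_def)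
    then show "x \<in> (\<Union>m. W m)" by blast
  qed
  moreover have "bounded (W m)" for m
    using U(2) by (auto simp: W_def split: prod.split)
  moreover have "(\<Sum>m. hausdorff_weight s (W m)) \<le> ennreal e"
  proof -
    have "(\<Sum>m. hausdorff_weight s (W m)) = (\<Sum>m. (\<lambda>(k, n). hausdorff_weight s (U k n)) (prod_decode m))"
      by (simp add: W_def case_prod_unfold)
    also have "\<dots> = (\<Sum>k. \<Sum>n. hausdorff_weight s (U k n))"
      by (subst suminf_ennreal_2dimen[OF refl]) (auto simp: )
    also have "\<dots> \<le> (\<Sum>k. ennreal (e * (1/2) ^ Suc k))"
      by (intro suminf_le less_imp_le[OF U(3)]) auto
    also have "\<dots> = ennreal e"
      using sums_mult[OF power_half_series, of e] e
      by (intro suminf_ennreal_eq) auto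
    finally show ?thesis .
  qed
  ultimately show "\<exists>W::nat \<Rightarrow> 'a set. (\<Union>k. A k) \<subseteq> (\<Union>n. W n) \<and> (\<forall>n. bounded (W n)) \<and>
      (\<Sum>n. hausdorff_weight s (W n)) \<le> ennreal e" by blast
qed

lemma hausdorff_null_subset:
  fixes A :: "'a::euclidean_space set"
  assumes "s > 0" "hausdorff_measure s B = 0" "A \<subseteq> B"
  shows "hausdorff_measure s A = 0"
proof (rule hausdorff_null_if_small_covers[OF assms(1)])
  fix e :: real assume e: "e > 0"
  obtain U :: "nat \<Rightarrow> 'a set" where "B \<subseteq> (\<Union>n. U n)" "\<forall>n. bounded (U n)" "\<forall>n. diameter (U n) \<le> 1"
    "(\<Sum>n. hausdorff_weight s (U n)) < ennreal e"
    by (rule hausdorff_null_small_cover[OF assms(2) e])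
  then show "\<exists>W::nat \<Rightarrow> 'a set. A \<subseteq> (\<Union>n. W n) \<and> (\<forall>n. bounded (W n)) \<and>
      (\<Sum>n. hausdorff_weight s (W n)) \<le> ennreal e"
    using assms(3) by (intro exI[of _ U]) auto
qed

text \<open>
  The form in which nullity is verified below: the covers consist of cylinders, indexed by
  finite sets of words.
\<close>

lemma hausdorff_null_if_finite_covers:
  fixes A :: "'a::euclidean_space set" and W :: "'b \<Rightarrow> 'a set"
  assumes s: "s > 0"
    and cov: "\<And>e. e > 0 \<Longrightarrow> \<exists>F. finite F \<and> A \<subseteq> (\<Union>I\<in>F. W I) \<and> (\<forall>I\<in>F. bounded (W I)) \<and>
      (\<Sum>I\<in>F. diameter (W I) powr s) \<le> e"
  shows "hausdorff_measure s A = 0"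
proof (rule hausdorff_null_if_small_covers[OF s])
  fix e :: real assume "e > 0"
  from cov[OF this] obtain F where F: "finite F" "A \<subseteq> (\<Union>I\<in>F. W I)" "\<And>I. I \<in> F \<Longrightarrow> bounded (W I)"
    "(\<Sum>I\<in>F. diameter (W I) powr s) \<le> e" by blast
  obtain h where h: "bij_betw h {0..<card F} F"
    using ex_bij_betw_nat_finite[OF F(1)] by blast
  define U where "U n = (if n < card F then W (h n) else {})" for n
  have hF: "h n \<in> F" if "n < card F" for n using h that by (auto simp: bij_betw_def)
  have "(\<Sum>n. hausdorff_weight s (U n)) = (\<Sum>n\<in>{0..<card F}. hausdorff_weight s (U n))"
    by (intro suminf_finite) (auto simp: U_def hausdorff_weight_def)
  also have "\<dots> \<le> (\<Sum>n\<in>{0..<card F}. ennreal (diameter (W (h n)) powr s))"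
    using s by (intro sum_mono) (auto simp: U_def hausdorff_weight_def)
  also have "\<dots> = (\<Sum>I\<in>F. ennreal (diameter (W I) powr s))"
    using h by (rule sum.reindex_bij_betw)
  also have "\<dots> = ennreal (\<Sum>I\<in>F. diameter (W I) powr s)"
    by (rule sum_ennreal) auto
  also have "\<dots> \<le> ennreal e" using F(4) by (rule ennreal_leI)
  finally have "(\<Sum>n. hausdorff_weight s (U n)) \<le> ennreal e" .
  moreover have "A \<subseteq> (\<Union>n. U n)"
  proof
    fix x assume "x \<in> A"
    then obtain I where I: "I \<in> F" "x \<in> W I" using F(2) by blast
    have "I \<in> h ` {0..<card F}" using bij_betw_imp_surj_on[OF h] I(1) by blast
    then obtain n where "I = h n" "n \<in> {0..<card F}" by (rule imageE)
    then have "n < card F" "h n = I" by simp_all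
    then have "x \<in> U n" using I by (simp add: U_def)
    then show "x \<in> (\<Union>n. U n)" by blast
  qed
  moreover have "bounded (U n)" for n using F(3) hF by (auto simp: U_def)
  ultimately show "\<exists>W::nat \<Rightarrow> 'a set. A \<subseteq> (\<Union>n. W n) \<and> (\<forall>n. bounded (W n)) \<and>
      (\<Sum>n. hausdorff_weight s (W n)) \<le> ennreal e" by blast
qed

text \<open>
  Replacing each covering set by a slightly larger open ball around one of its points makes
  compactness applicable; the excess in the radii is summable and as small as desired. Empty
  covering sets still receive a tiny ball around an arbitrary point, so that all radii are positive.
\<close>

lemma hausdorff_null_ball_cover:
  fixes A :: "'a::euclidean_space set"
  assumes null: "hausdorff_measure s A = 0" and s: "s > 0" and e: "e > 0"
  obtains p :: "nat \<Rightarrow> 'a" and d :: "nat \<Rightarrow> real"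
  where "A \<subseteq> (\<Union>n. ball (p n) (d n))" "\<forall>n. d n > 0"
    "\<forall>F. finite F \<longrightarrow> (\<Sum>n\<in>F. d n powr s) \<le> e"
proof -
  have e2: "e / 2 > 0" using e by simp
  obtain U :: "nat \<Rightarrow> 'a set" where U: "A \<subseteq> (\<Union>n. U n)" "\<forall>n. bounded (U n)"
    "\<forall>n. diameter (U n) \<le> 1" "(\<Sum>n. hausdorff_weight s (U n)) < ennreal (e/2)"
    by (rule hausdorff_null_small_cover[OF null e2])
  define b where "b n = (e/2) * (1/2) ^ Suc n" for n :: nat
  have b: "b n > 0" for n using e by (simp add: b_def)
  define w where "w n = (if U n = {} then 0 else diameter (U n) powr s)" for n
  have w: "w n \<ge> 0" for n by (simp add: w_def)
  define d where "d n = (w n + b n) powr (1/s)" for n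
  define p where "p n = (SOME x. x \<in> U n)" for n
  have ds: "d n powr s = w n + b n" for n
    using s b[of n] w[of n] by (simp add: d_def powr_powr)
  have dpos: "d n > 0" for n using b[of n] w[of n] by (simp add: d_def)
  have "U n \<subseteq> ball (p n) (d n)" for n
  proof
    fix x assume x: "x \<in> U n"
    then have p: "p n \<in> U n" unfolding p_def by (metis someI)
    have "dist (p n) x \<le> diameter (U n)"
      using diameter_bounded_bound[OF _ p x] U(2) by blast
    moreover have "diameter (U n) < d n"
    proof (rule ccontr)
      assume "\<not> diameter (U n) < d n"
      then have "d n powr s \<le> diameter (U n) powr s"
        using dpos[of n] s by (intro powr_mono2) auto
      moreover have "w n = diameter (U n) powr s" using x by (auto simp: w_def)
      ultimately show False using ds[of n] b[of n] by linarith
    qed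
    ultimately show "x \<in> ball (p n) (d n)" by simp
  qed
  then have "A \<subseteq> (\<Union>n. ball (p n) (d n))" using U(1) by (intro order_trans[OF U(1)] UN_mono) auto
  moreover have "(\<Sum>n\<in>F. d n powr s) \<le> e" if F: "finite F" for F
  proof -
    have "ennreal (\<Sum>n\<in>F. w n) = (\<Sum>n\<in>F. hausdorff_weight s (U n))"
    proof -
      have "(\<Sum>n\<in>F. hausdorff_weight s (U n)) = (\<Sum>n\<in>F. ennreal (w n))"
        using s by (intro sum.cong) (auto simp: w_def hausdorff_weight_def)
      also have "\<dots> = ennreal (\<Sum>n\<in>F. w n)" using w by (intro sum_ennreal) auto
      finally show ?thesis by simp
    qed
    also have "\<dots> \<le> (\<Sum>n. hausdorff_weight s (U n))"
      using F by (intro sum_le_suminf) auto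
    also have "\<dots> \<le> ennreal (e/2)" using U(4) by simp
    finally have "(\<Sum>n\<in>F. w n) \<le> e/2" using e by simp
    moreover have "(\<Sum>n\<in>F. b n) \<le> e/2"
    proof -
      have bs: "b sums (e/2)"
        using sums_mult[OF power_half_series, of "e/2"] by (simp add: b_def[abs_def])
      have "(\<Sum>n\<in>F. b n) \<le> suminf b"
        using bs b F by (intro sum_le_suminf) (auto simp: sums_iff less_imp_le)
      then show ?thesis using bs by (simp add: sums_iff)
    qed
    ultimately show ?thesis by (simp add: ds sum.distrib)
  qed
  ultimately show thesis using dpos by (intro that[of p d]) auto
qed

lemma hausdorff_dim_le:
  assumes "0 \<le> t" "hausdorff_measure t A = 0"
  shows "hausdorff_dim A \<le> t"
  unfolding hausdorff_dim_def using assms by (intro cInf_lower) (auto intro!: bdd_belowI[of _ 0])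

lemma hausdorff_null_above_dim:
  assumes ex: "0 \<le> t0" "hausdorff_measure t0 A = 0" and t: "hausdorff_dim A < t"
  shows "hausdorff_measure t A = 0"
proof -
  have "{s. 0 \<le> s \<and> hausdorff_measure s A = 0} \<noteq> {}" using ex by blast
  from cInf_lessD[OF this t[unfolded hausdorff_dim_def]] show ?thesis using hausdorff_null_mono_exponent by blast
qed

lemma hausdorff_null_singleton: "0 < s \<Longrightarrow> hausdorff_measure s {x} = 0"
  by (rule hausdorff_null_if_finite_covers[where W = "\<lambda>_::unit. {x}"])
     (auto intro!: exI[of _ "{()}"])

text \<open>
  Positive dimension is used in the form that the attractor has two points, whose images
  then bound the diameters of all cylinders from below.
\<close>

lemma two_points_if_positive_dim:
  assumes "0 < hausdorff_dim X" "x \<in> X"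
  obtains y where "y \<in> X" "x \<noteq> y"
proof (cases "X = {x}")
  case True
  have "0 < hausdorff_dim X / 2" using assms(1) by simp
  then have "hausdorff_measure (hausdorff_dim X / 2) X = 0"
    using hausdorff_null_singleton[of "hausdorff_dim X / 2" x] True by simp
  then have "hausdorff_dim X \<le> hausdorff_dim X / 2"
    using assms(1) by (intro hausdorff_dim_le) auto
  then show thesis using assms(1) by simp
qed (use assms(2) that in blast)

section \<open>Quasi-multiplicative weights on words\<close>

text \<open>
  The combinatorial side of the argument depends only on a weight on the words over a finite
  alphabet that is multiplicative up to the factor \<open>K\<close>, with letters of weight at least \<open>a\<close>.
\<close>

locale word_weights =
  fixes D :: "'i set" and \<Lambda> :: "'i list \<Rightarrow> real" and K a :: real
  assumes finite_D: "finite D" and D_nonempty: "D \<noteq> {}"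
    and K_ge_1: "1 \<le> K" and a_pos: "0 < a"
    and weight_pos: "I \<in> lists D \<Longrightarrow> 0 < \<Lambda> I"
    and weight_Nil: "\<Lambda> [] = 1"
    and weight_append_le: "I \<in> lists D \<Longrightarrow> J \<in> lists D \<Longrightarrow> \<Lambda> (I @ J) \<le> K * \<Lambda> I * \<Lambda> J"
    and weight_append_ge: "I \<in> lists D \<Longrightarrow> J \<in> lists D \<Longrightarrow> \<Lambda> I * \<Lambda> J \<le> K * \<Lambda> (I @ J)"
    and weight_letter_ge: "i \<in> D \<Longrightarrow> a \<le> \<Lambda> [i]"
begin

definition words :: "nat \<Rightarrow> 'i list set" where
  "words n = {I \<in> lists D. length I = n}"

text \<open>
  The exponential growth rate of these sums in \<open>n\<close> is the topological pressure at the exponent \<open>t\<close>.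
\<close>

definition pressure_sum :: "real \<Rightarrow> nat \<Rightarrow> real" where
  "pressure_sum t n = (\<Sum>I\<in>words n. \<Lambda> I powr t)"

text \<open>
  The mass of the words of length \<open>|I| + n\<close> that extend \<open>I\<close>. It stands in for a Gibbs measure of the
  cylinder of \<open>I\<close>: for a fixed total length it is exactly additive over extensions of \<open>I\<close>, and it is
  comparable with \<open>\<Lambda>(I)\<^sup>t\<close> whenever the pressure sums are bounded above and below.
\<close>

definition mass_below :: "real \<Rightarrow> nat \<Rightarrow> 'i list \<Rightarrow> real" where
  "mass_below t n I = (\<Sum>J\<in>words n. \<Lambda> (I @ J) powr t)"

lemma finite_words [simp]: "finite (words n)"
proof -
  have "words n = {xs. set xs \<subseteq> D \<and> length xs = n}"
    by (auto simp: words_def in_lists_conv_set)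
  then show ?thesis using finite_lists_length_eq[OF finite_D] by simp
qed

lemma card_words: "card (words n) = card D ^ n"
proof -
  have "words n = {xs. set xs \<subseteq> D \<and> length xs = n}"
    by (auto simp: words_def in_lists_conv_set)
  then show ?thesis using card_lists_length_eq[OF finite_D] by simp
qed

lemma words_nonempty: "words n \<noteq> {}"
proof -
  obtain i where "i \<in> D" using D_nonempty by blast
  then have "replicate n i \<in> words n" by (auto simp: words_def in_lists_conv_set)
  then show ?thesis by blast
qed

lemma words_lists: "I \<in> words n \<Longrightarrow> I \<in> lists D"
  by (simp add: words_def)

lemma words_0 [simp]: "words 0 = {[]}"
  by (auto simp: words_def)

lemma sum_words_add:
  fixes f :: "'i list \<Rightarrow> real"
  shows "(\<Sum>I\<in>words (m + n). f I) = (\<Sum>I\<in>words m. \<Sum>J\<in>words n. f (I @ J))"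
proof -
  have "bij_betw (\<lambda>(I, J). I @ J) (words m \<times> words n) (words (m + n))"
    unfolding bij_betw_def
  proof
    show "inj_on (\<lambda>(I, J). I @ J) (words m \<times> words n)"
      by (auto simp: inj_on_def words_def)
    show "(\<lambda>(I, J). I @ J) ` (words m \<times> words n) = words (m + n)" (is "?L = _")
    proof
      show "?L \<subseteq> words (m + n)" by (auto simp: words_def)
      show "words (m + n) \<subseteq> ?L"
      proof
        fix I assume I: "I \<in> words (m + n)"
        then have "take m I \<in> words m" "drop m I \<in> words n"
          by (auto simp: words_def in_lists_conv_set dest: in_set_takeD in_set_dropD)
        then have "(take m I, drop m I) \<in> words m \<times> words n" by simp
        then have "(\<lambda>(I, J). I @ J) (take m I, drop m I) \<in> ?L" by (rule imageI)
        then show "I \<in> ?L" by simp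
      qed
    qed
  qed
  then have "(\<Sum>I\<in>words (m + n). f I) = (\<Sum>p\<in>words m \<times> words n. f (case p of (I, J) \<Rightarrow> I @ J))"
    by (rule sum.reindex_bij_betw[symmetric])
  also have "\<dots> = (\<Sum>I\<in>words m. \<Sum>J\<in>words n. f (I @ J))"
    by (subst sum.cartesian_product) (simp add: case_prod_unfold)
  finally show ?thesis .
qed

lemma pressure_sum_0 [simp]: "pressure_sum t 0 = 1"
  by (simp add: pressure_sum_def weight_Nil)

lemma pressure_sum_pos: "0 < pressure_sum t n"
  unfolding pressure_sum_def
proof (rule sum_pos)
  fix I assume "I \<in> words n"
  then show "0 < \<Lambda> I powr t" using weight_pos[of I] words_lists by simp
qed (use words_nonempty in auto)

lemma mass_below_pos: "I \<in> lists D \<Longrightarrow> 0 < mass_below t n I"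
  unfolding mass_below_def
proof (rule sum_pos)
  fix J assume "I \<in> lists D" "J \<in> words n"
  then show "0 < \<Lambda> (I @ J) powr t" using weight_pos[of "I @ J"] words_lists by simp
qed (use words_nonempty in auto)

lemma mass_below_0 [simp]: "mass_below t 0 I = \<Lambda> I powr t"
  by (simp add: mass_below_def)

lemma pressure_sum_add: "pressure_sum t (m + n) = (\<Sum>I\<in>words m. mass_below t n I)"
  by (simp add: pressure_sum_def mass_below_def sum_words_add)

lemma mass_below_add: "mass_below t (m + n) I = (\<Sum>J\<in>words m. mass_below t n (I @ J))"
  by (simp add: mass_below_def sum_words_add)

lemma weight_append_powr_le:
  assumes "0 \<le> t" "I \<in> lists D" "J \<in> lists D"
  shows "\<Lambda> (I @ J) powr t \<le> K powr t * \<Lambda> I powr t * \<Lambda> J powr t"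
proof -
  have "\<Lambda> (I @ J) powr t \<le> (K * \<Lambda> I * \<Lambda> J) powr t"
    using assms weight_append_le weight_pos[of "I @ J"] by (intro powr_mono2) auto
  then show ?thesis
    using assms weight_pos[of I] weight_pos[of J] K_ge_1 by (simp add: powr_mult)
qed

lemma weight_append_powr_ge:
  assumes "0 \<le> t" "I \<in> lists D" "J \<in> lists D"
  shows "\<Lambda> I powr t * \<Lambda> J powr t \<le> K powr t * \<Lambda> (I @ J) powr t"
proof -
  have "(\<Lambda> I * \<Lambda> J) powr t \<le> (K * \<Lambda> (I @ J)) powr t"
    using assms weight_append_ge weight_pos[of I] weight_pos[of J] by (intro powr_mono2) auto
  then show ?thesis
    using assms weight_pos[of I] weight_pos[of J] weight_pos[of "I @ J"] K_ge_1
    by (simp add: powr_mult)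
qed

lemma mass_below_le:
  assumes "0 \<le> t" "I \<in> lists D"
  shows "mass_below t n I \<le> K powr t * \<Lambda> I powr t * pressure_sum t n"
  unfolding mass_below_def pressure_sum_def sum_distrib_left
  using assms words_lists by (intro sum_mono weight_append_powr_le) auto

lemma mass_below_ge:
  assumes "0 \<le> t" "I \<in> lists D"
  shows "\<Lambda> I powr t * pressure_sum t n \<le> K powr t * mass_below t n I"
  unfolding mass_below_def pressure_sum_def sum_distrib_left
  using assms words_lists by (intro sum_mono weight_append_powr_ge) auto

lemma pressure_sum_add_ge:
  assumes "0 \<le> t"
  shows "pressure_sum t m * pressure_sum t n \<le> K powr t * pressure_sum t (m + n)"
proof -
  have "pressure_sum t m * pressure_sum t n = (\<Sum>I\<in>words m. \<Lambda> I powr t * pressure_sum t n)"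
    by (simp add: pressure_sum_def sum_distrib_right)
  also have "\<dots> \<le> (\<Sum>I\<in>words m. K powr t * mass_below t n I)"
    using assms words_lists by (intro sum_mono mass_below_ge) auto
  also have "\<dots> = K powr t * pressure_sum t (m + n)"
    by (simp add: pressure_sum_add sum_distrib_left)
  finally show ?thesis .
qed

text \<open>
  A single sum above the multiplicativity constant forces the sums along multiples of \<open>m\<close>
  to stay at least \<open>1\<close>, and this strict inequality survives a small increase of the exponent.
\<close>

lemma pressure_sum_exceeds_at_larger_exponent:
  assumes s: "0 \<le> s" and big: "K powr s < pressure_sum s m"
  obtains t c where "s < t" "0 < c" "\<And>n. c \<le> pressure_sum t n"
proof -
  have "((\<lambda>t. pressure_sum t m - K powr t) \<longlongrightarrow> pressure_sum s m - K powr s) (at_right s)"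
    unfolding pressure_sum_def using K_ge_1 weight_pos[OF words_lists, THEN less_imp_neq, THEN not_sym]
    by (auto intro!: tendsto_intros)
  then have "\<forall>\<^sub>F t in at_right s. 0 < pressure_sum t m - K powr t"
    using big by (intro order_tendstoD(1)) auto
  moreover have "\<forall>\<^sub>F t in at_right s. s < t" by (simp add: eventually_at_right_less)
  ultimately have "\<forall>\<^sub>F t in at_right s. 0 < pressure_sum t m - K powr t \<and> s < t"
    by (rule eventually_conj)
  then obtain t where t: "s < t" "K powr t < pressure_sum t m"
    using eventually_happens'[OF trivial_limit_at_right_real] by fastforce
  have t0: "0 \<le> t" using s t by simp
  have Kt: "0 < K powr t" using K_ge_1 by simp
  \<comment> \<open>The surplus over \<open>K powr t\<close> absorbs the loss in each concatenation.\<close>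
  have mult: "1 \<le> pressure_sum t (j * m)" for j
  proof (induction j)
    case (Suc j)
    have "K powr t * 1 \<le> pressure_sum t m * pressure_sum t (j * m)"
      using Suc t Kt pressure_sum_pos[of t m] by (intro mult_mono) auto
    also have "\<dots> \<le> K powr t * pressure_sum t (m + j * m)"
      by (rule pressure_sum_add_ge[OF t0])
    finally show ?case using Kt by simp
  qed simp
  have m0: "m > 0"
  proof (rule ccontr)
    assume "\<not> m > 0"
    then show False using big K_ge_1 s by (simp add: ge_one_powr_ge_zero leD)
  qed
  define c where "c = Min (pressure_sum t ` {..<m}) / K powr t"
  have "0 < Min (pressure_sum t ` {..<m})"
    using m0 pressure_sum_pos by (subst Min_gr_iff) auto
  then have c: "0 < c" using Kt by (simp add: c_def)
  have "c \<le> pressure_sum t n" for n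
  proof -
    have n: "n = (n div m) * m + n mod m" by simp
    have "Min (pressure_sum t ` {..<m}) \<le> 1 * pressure_sum t (n mod m)"
      using m0 by simp
    also have "\<dots> \<le> pressure_sum t ((n div m) * m) * pressure_sum t (n mod m)"
      using mult[of "n div m"] pressure_sum_pos[of t "n mod m"]
      by (intro mult_right_mono) auto
    also have "\<dots> \<le> K powr t * pressure_sum t n"
      using pressure_sum_add_ge[OF t0, of "(n div m) * m" "n mod m"] by simp
    finally show ?thesis using Kt by (simp add: c_def field_simps)
  qed
  then show thesis using that t c by blast
qed

text \<open>
  The words from \<open>S\<close> extended by successive blocks of lengths \<open>|J 0|, |J 1|, \<dots>\<close> such that no block equals
  the word it is tested against.
\<close>

primrec survivors :: "'i list set \<Rightarrow> (nat \<Rightarrow> 'i list) \<Rightarrow> nat \<Rightarrow> 'i list set" where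
  "survivors S J 0 = S"
| "survivors S J (Suc t) =
    (\<lambda>(I, I'). I @ I') ` (survivors S J t \<times> (words (length (J t)) - {J t}))"

lemma survivors_words:
  assumes J: "\<And>t. J t \<in> lists D"
    and n: "\<And>t. N (Suc t) = N t + length (J t)"
  shows "survivors (words (N 0)) J t \<subseteq> words (N t)"
proof (induction t)
  case (Suc t)
  show ?case
  proof
    fix L assume "L \<in> survivors (words (N 0)) J (Suc t)"
    then obtain I I' where "L = I @ I'" "I \<in> survivors (words (N 0)) J t" "I' \<in> words (length (J t))"
      by auto
    then show "L \<in> words (N (Suc t))" using Suc.IH by (auto simp: words_def n simp del: in_listsI)
  qed
qed simp

text \<open>
  By quasi-multiplicativity, extending any word by \<open>J t\<close> captures a fixed multiple of
  \<open>\<Lambda>(J t)\<^sup>s\<close> of the mass below that word. Excluding \<open>J t\<close> thus multiplies the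
  remaining mass by at most \<open>1 - q \<Lambda>(J t)\<^sup>s \<le> exp (- q \<Lambda>(J t)\<^sup>s)\<close>, independently of the earlier blocks.
  In \<open>q\<close>, the ratio \<open>c / C\<close> compares the pressure sums of the tails with and without the block, and \<open>K\<^sup>3\<^sup>s\<close> accounts for splitting off \<open>I\<close>, then \<open>J t\<close>, then the tail.
\<close>

lemma survivors_mass_le:
  assumes s: "0 \<le> s" and J: "\<And>t. J t \<in> lists D"
    and N: "\<And>t. N (Suc t) = N t + length (J t)"
    and c: "0 < c" and lower: "\<And>n. c \<le> pressure_sum s n" and upper: "\<And>n. pressure_sum s n \<le> C"
  defines "q \<equiv> c / (C * (K powr s) ^ 3)"
  shows "(\<Sum>I\<in>survivors (words (N 0)) J t. \<Lambda> I powr s) \<le> C * exp (- q * (\<Sum>j<t. \<Lambda> (J j) powr s))"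
proof -
  define Q where "Q = K powr s"
  have Q: "0 < Q" using K_ge_1 by (simp add: Q_def)
  have C: "0 < C" using c lower[of 0] upper[of 0] by linarith
  have kill: "q * \<Lambda> L powr s * mass_below s (length L + n) I \<le> mass_below s n (I @ L)"
    if I: "I \<in> lists D" and L: "L \<in> lists D" for I L n
  proof -
    have "mass_below s (length L + n) I \<le> Q * \<Lambda> I powr s * C"
      using mass_below_le[OF s I, of "length L + n"] upper[of "length L + n"] Q
      by (fastforce simp: Q_def intro: order_trans mult_left_mono)
    then have "q * \<Lambda> L powr s * mass_below s (length L + n) I
        \<le> q * \<Lambda> L powr s * (Q * \<Lambda> I powr s * C)"
      using c C Q by (intro mult_left_mono) (auto simp: q_def)
    also have "\<dots> = (\<Lambda> I powr s * \<Lambda> L powr s) * c / Q\<^sup>2"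
      using C Q by (simp add: q_def Q_def[symmetric] field_simps power_numeral_reduce)
    also have "\<dots> \<le> (Q * \<Lambda> (I @ L) powr s) * c / Q\<^sup>2"
      using weight_append_powr_ge[OF s I L] c Q
      by (intro divide_right_mono mult_right_mono) (auto simp: Q_def)
    also have "\<dots> = \<Lambda> (I @ L) powr s * c / Q"
      using Q by (simp add: power2_eq_square)
    also have "\<dots> \<le> \<Lambda> (I @ L) powr s * pressure_sum s n / Q"
      using lower[of n] Q by (intro divide_right_mono mult_left_mono) auto
    also have "\<dots> \<le> (Q * mass_below s n (I @ L)) / Q"
      using mass_below_ge[OF s, of "I @ L" n] I L Q by (intro divide_right_mono) (auto simp: Q_def)
    also have "\<dots> = mass_below s n (I @ L)" using Q by simp
    finally show ?thesis .
  qed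
  let ?S = "survivors (words (N 0)) J"
  \<comment> \<open>Additivity is exact only at a fixed total length, so the induction
    has to carry the masses below survivors for every remaining depth \<open>n\<close>.\<close>
  have "(\<Sum>I\<in>?S t. mass_below s n I) \<le> C * exp (- q * (\<Sum>j<t. \<Lambda> (J j) powr s))" for n
  proof (induction t arbitrary: n)
    case 0
    show ?case using upper[of "N 0 + n"] by (simp add: pressure_sum_add)
  next
    case (Suc t)
    let ?k = "length (J t)"
    have sub: "?S t \<subseteq> words (N t)" using J N by (rule survivors_words[of J N])
    have inj: "inj_on (\<lambda>(I, I'). I @ I') (?S t \<times> (words ?k - {J t}))"
      using sub by (force simp: inj_on_def words_def)
    have "(\<Sum>I\<in>?S (Suc t). mass_below s n I)
        = (\<Sum>p\<in>?S t \<times> (words ?k - {J t}). mass_below s n (case p of (I, I') \<Rightarrow> I @ I'))"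
      by (simp add: sum.reindex[OF inj] comp_def)
    also have "\<dots> = (\<Sum>I\<in>?S t. \<Sum>I'\<in>words ?k - {J t}. mass_below s n (I @ I'))"
      by (subst sum.cartesian_product) (simp add: case_prod_unfold)
    also have "\<dots> \<le> (\<Sum>I\<in>?S t. (1 - q * \<Lambda> (J t) powr s) * mass_below s (?k + n) I)"
    proof (rule sum_mono)
      fix I assume "I \<in> ?S t"
      then have I: "I \<in> lists D" using sub words_lists by blast
      have Jt: "J t \<in> words ?k" using J by (simp add: words_def)
      have "(\<Sum>I'\<in>words ?k - {J t}. mass_below s n (I @ I'))
          = mass_below s (?k + n) I - mass_below s n (I @ J t)"
        using Jt by (simp add: mass_below_add sum_diff1)
      then show "(\<Sum>I'\<in>words ?k - {J t}. mass_below s n (I @ I'))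
          \<le> (1 - q * \<Lambda> (J t) powr s) * mass_below s (?k + n) I"
        using kill[OF I J, of t n] by (simp add: algebra_simps)
    qed
    also have "\<dots> = (1 - q * \<Lambda> (J t) powr s) * (\<Sum>I\<in>?S t. mass_below s (?k + n) I)"
      by (simp add: sum_distrib_left)
    also have "\<dots> \<le> exp (- q * \<Lambda> (J t) powr s) * (C * exp (- q * (\<Sum>j<t. \<Lambda> (J j) powr s)))"
    proof (intro mult_mono Suc.IH)
      show "1 - q * \<Lambda> (J t) powr s \<le> exp (- q * \<Lambda> (J t) powr s)"
        using exp_ge_add_one_self[of "- q * \<Lambda> (J t) powr s"] by simp
      show "0 \<le> (\<Sum>I\<in>?S t. mass_below s (?k + n) I)"
        using sub words_lists by (intro sum_nonneg less_imp_le[OF mass_below_pos]) auto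
    qed simp
    finally show ?case by (simp add: mult_ac exp_add[symmetric] algebra_simps)
  qed
  from this[of 0] show ?thesis by simp
qed

text \<open>
  The words at which the weight first falls below \<open>d\<close>. For \<open>d \<le> 1\<close> their cylinders all have size about \<open>d\<close>,
  whatever their lengths, and none of them is a prefix of another.
\<close>

definition stopping_words :: "real \<Rightarrow> 'i list set" where
  "stopping_words d = {J \<in> lists D. \<Lambda> J < d \<and> (\<forall>I. strict_prefix I J \<longrightarrow> d \<le> \<Lambda> I)}"

lemma stopping_words_lists: "J \<in> stopping_words d \<Longrightarrow> J \<in> lists D"
  and stopping_words_less: "J \<in> stopping_words d \<Longrightarrow> \<Lambda> J < d"
  by (auto simp: stopping_words_def)

lemma stopping_words_parallel:
  assumes "I \<in> stopping_words d" "J \<in> stopping_words d" "I \<noteq> J"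
  shows "I \<parallel> J"
  using assms unfolding stopping_words_def
  by (force simp: parallel_def strict_prefix_def)

lemma stopping_prefix:
  assumes "I \<in> lists D" "\<Lambda> I < d"
  obtains J J' where "I = J @ J'" "J \<in> stopping_words d"
proof -
  define P where "P k \<longleftrightarrow> k \<le> length I \<and> \<Lambda> (take k I) < d" for k
  have "P (length I)" using assms by (simp add: P_def)
  define k where "k = (LEAST k. P k)"
  have Pk: "P k" unfolding k_def using \<open>P (length I)\<close> by (rule LeastI)
  have least: "\<not> P j" if "j < k" for j using that not_less_Least unfolding k_def by blast
  have "take k I \<in> stopping_words d"
    unfolding stopping_words_def
  proof (intro CollectI conjI allI impI)
    show "take k I \<in> lists D" using assms by (auto simp: in_lists_conv_set dest: in_set_takeD)
    show "\<Lambda> (take k I) < d" using Pk by (simp add: P_def)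
    fix L assume L: "strict_prefix L (take k I)"
    then obtain M where M: "take k I = L @ M" "M \<noteq> []"
      by (auto elim: strict_prefixE')
    then have len: "length L < k" using Pk
      by (metis P_def append_eq_conv_conj length_append length_greater_0_conv length_take less_add_same_cancel1 min.absorb2)
    have "L = take (length L) (take k I)" using M by simp
    then have "L = take (length L) I" using len by (simp add: min_def)
    then show "d \<le> \<Lambda> L" using least[OF len] Pk len by (auto simp: P_def)
  qed
  then show thesis using that[of "take k I" "drop k I"] by simp
qed

lemma stopping_words_butlast:
  assumes J: "J \<in> stopping_words d" and d: "d \<le> 1"
  shows "J \<noteq> []" "butlast J \<in> lists D" "d \<le> \<Lambda> (butlast J)" "a / K * d \<le> \<Lambda> J"
proof -
  show ne: "J \<noteq> []" using J d weight_Nil by (auto simp: stopping_words_def)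
  have l: "J \<in> lists D" using J by (rule stopping_words_lists)
  then show b: "butlast J \<in> lists D" by (auto simp: in_lists_conv_set dest: in_set_butlastD)
  have "strict_prefix (butlast J) J"
    using ne by (metis append_butlast_last_id strict_prefixI')
  then show db: "d \<le> \<Lambda> (butlast J)" using J by (simp add: stopping_words_def)
  have last: "last J \<in> D" using ne l by (auto simp: in_lists_conv_set)
  have "a * d \<le> \<Lambda> [last J] * \<Lambda> (butlast J)"
  proof (cases "d \<ge> 0")
    case True
    then show ?thesis using weight_letter_ge[OF last] db a_pos by (intro mult_mono) auto
  next
    case False
    then have "a * d \<le> 0" using a_pos by (simp add: mult_le_0_iff)
    also have "0 \<le> \<Lambda> [last J] * \<Lambda> (butlast J)"
      using weight_letter_ge[OF last] a_pos weight_pos[OF b] by simp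
    finally show ?thesis .
  qed
  also have "\<dots> \<le> K * \<Lambda> J"
    using weight_append_ge[OF b, of "[last J]"] last ne by (simp add: mult.commute)
  finally show "a / K * d \<le> \<Lambda> J" using K_ge_1 by (simp add: field_simps)
qed

end

section \<open>Bounded distortion in conformal systems\<close>

text \<open>
  A quantitative open mapping theorem. To hit a given \<open>y\<close>, minimise \<open>|f p - y| + l |p - x|\<close> over the closed
  ball, with \<open>l\<close> strictly between \<open>|f x - y| / \<rho>\<close> and \<open>m\<close>. Comparison with \<open>p = x\<close> puts the minimiser in the interior, and if \<open>f p \<noteq> y\<close>
  then moving \<open>p\<close> in the direction that the derivative sends to \<open>y - f p\<close> lowers the first term at
  a rate exceeding the growth of the second.
\<close>

lemma ball_subset_image_of_expanding_derivative:
  fixes f :: "'a::euclidean_space \<Rightarrow> 'a"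
  assumes \<rho>: "0 < \<rho>"
    and der: "\<And>p. p \<in> cball x \<rho> \<Longrightarrow> (f has_derivative f' p) (at p)"
    and onto: "\<And>p v. p \<in> cball x \<rho> \<Longrightarrow> \<exists>u. f' p u = v \<and> m * norm u \<le> norm v"
  shows "ball (f x) (m * \<rho>) \<subseteq> f ` ball x \<rho>"
proof
  fix y assume "y \<in> ball (f x) (m * \<rho>)"
  then have "norm (f x - y) / \<rho> < m" using \<rho> by (simp add: dist_norm field_simps)
  then obtain l where l: "norm (f x - y) / \<rho> < l" "l < m" using dense by blast
  have l0: "0 < l" using l(1) \<rho> by (meson divide_nonneg_pos norm_ge_zero le_less_trans)
  define h where "h p = norm (f p - y) + l * norm (p - x)" for p
  have "continuous_on (cball x \<rho>) f"
    using der by (meson continuous_at_imp_continuous_on has_derivative_continuous)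
  then have "continuous_on (cball x \<rho>) h"
    unfolding h_def by (intro continuous_intros)
  then obtain p where p: "p \<in> cball x \<rho>" "\<And>z. z \<in> cball x \<rho> \<Longrightarrow> h p \<le> h z"
    using continuous_attains_inf[of "cball x \<rho>" h] \<rho> by auto
  have "l * norm (p - x) \<le> h p" by (simp add: h_def)
  also have "h p \<le> h x" using p(2)[of x] \<rho> by simp
  also have "\<dots> < l * \<rho>" using l(1) \<rho> by (simp add: h_def field_simps)
  finally have px: "norm (p - x) < \<rho>" using l0 by simp
  have "f p = y"
  proof (rule ccontr)
    assume ne: "f p \<noteq> y"
    obtain u where u: "f' p u = y - f p" "m * norm u \<le> norm (y - f p)" using onto[OF p(1)] by blast
    interpret A: bounded_linear "f' p" using der[OF p(1)] by (rule has_derivative_bounded_linear)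
    have u0: "0 < norm u" using u(1) ne A.zero by auto
    define e where "e = (m - l) / 2"
    have e: "0 < e" "e + l < m" using l(2) by (simp_all add: e_def field_simps)
    obtain d where d: "0 < d"
      "\<And>z. norm (z - p) < d \<Longrightarrow> norm (f z - f p - f' p (z - p)) \<le> e * norm (z - p)"
      using der[OF p(1)] e(1) unfolding has_derivative_at_alt by blast
    \<comment> \<open>The step is short enough to stay in the ball and in the range where the linear
      approximation has error at most \<open>e t |u|\<close>.\<close>
    define t where "t = min (1/2) (min d (\<rho> - norm (p - x)) / (2 * norm u))"
    have t: "0 < t" "t < 1" using d(1) px u0 by (auto simp: t_def min_def)
    have "t * norm u \<le> min d (\<rho> - norm (p - x)) / (2 * norm u) * norm u"
      unfolding t_def by (intro mult_right_mono) auto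
    also have "\<dots> = min d (\<rho> - norm (p - x)) / 2" using u0 by simp
    also have "\<dots> < min d (\<rho> - norm (p - x))"
    proof -
      have half: "z / 2 < z" if "0 < z" for z :: real using that by simp
      show ?thesis using d(1) px by (intro half) simp
    qed
    finally have tu: "t * norm u < d" "t * norm u < \<rho> - norm (p - x)" by auto
    define z where "z = p + t *\<^sub>R u"
    have zp: "norm (z - p) = t * norm u" using t by (simp add: z_def)
    have zx: "norm (z - x) \<le> norm (p - x) + t * norm u"
      using norm_triangle_ineq[of "p - x" "t *\<^sub>R u"] t by (simp add: z_def algebra_simps)
    have zin: "z \<in> cball x \<rho>" using zx tu(2) by (simp add: dist_norm norm_minus_commute)
    have fz: "norm (f z - f p - t *\<^sub>R (y - f p)) \<le> e * (t * norm u)"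
      using d(2)[of z] zp tu(1) u(1) t(1) by (simp add: z_def A.scaleR)
    have "f z - y = (f z - f p - t *\<^sub>R (y - f p)) + (1 - t) *\<^sub>R (f p - y)"
      by (simp add: algebra_simps)
    then have "norm (f z - y) \<le> norm (f z - f p - t *\<^sub>R (y - f p)) + norm ((1 - t) *\<^sub>R (f p - y))"
      by (metis norm_triangle_ineq)
    then have "norm (f z - y) \<le> norm (f z - f p - t *\<^sub>R (y - f p)) + (1 - t) * norm (f p - y)"
      using t by simp
    then have "norm (f z - y) \<le> e * (t * norm u) + (1 - t) * norm (f p - y)" using fz by linarith
    moreover have "l * norm (z - x) \<le> l * norm (p - x) + l * (t * norm u)"
      using mult_left_mono[OF zx, of l] l0 by (simp add: algebra_simps)
    ultimately have "h z \<le> h p + t * ((e + l) * norm u - norm (f p - y))"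
      by (simp add: h_def algebra_simps)
    moreover have "(e + l) * norm u < m * norm u" using e(2) u0 by (rule mult_strict_right_mono)
    then have "t * ((e + l) * norm u - norm (f p - y)) < 0"
      using u(2) t(1) by (intro mult_pos_neg) (auto simp: norm_minus_commute)
    ultimately show False using p(2)[OF zin] by linarith
  qed
  then show "y \<in> f ` ball x \<rho>" using px by (auto simp: dist_norm norm_minus_commute)
qed

text \<open>
  The maps of the system restricted to a bounded forward invariant set \<open>T\<close> that contains a uniform
  neighbourhood of the attractor. On such a set arbitrary compositions are defined and differentiable, although
  the original neighbourhood of \<open>Y\<close> need not be mapped into itself. In general \<open>T\<close> is disconnected.
\<close>

locale conformal_system =
  fixes D :: "'i set" and \<phi> :: "'i \<Rightarrow> 'a::euclidean_space \<Rightarrow> 'a"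
    and \<phi>' :: "'i \<Rightarrow> 'a \<Rightarrow> 'a \<Rightarrow>\<^sub>L 'a" and T X :: "'a set"
    and r a c \<alpha> \<Delta> \<rho> :: real and x0 y0 :: 'a
  assumes finite_alphabet: "finite D"
    and r: "0 < r" "r < 1" and a: "0 < a" "a \<le> 1" and c: "0 < c" and \<alpha>: "0 < \<alpha>" and \<rho>: "0 < \<rho>"
    and maps_into: "i \<in> D \<Longrightarrow> x \<in> T \<Longrightarrow> \<phi> i x \<in> T"
    and lipschitz: "i \<in> D \<Longrightarrow> x \<in> T \<Longrightarrow> y \<in> T \<Longrightarrow> dist (\<phi> i x) (\<phi> i y) \<le> r * dist x y"
    and inj_maps: "i \<in> D \<Longrightarrow> inj_on (\<phi> i) T"
    and derivative: "i \<in> D \<Longrightarrow> x \<in> T \<Longrightarrow> (\<phi> i has_derivative blinfun_apply (\<phi>' i x)) (at x)"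
    and conformal: "i \<in> D \<Longrightarrow> x \<in> T \<Longrightarrow> norm (blinfun_apply (\<phi>' i x) v) = norm (\<phi>' i x) * norm v"
    and derivative_ge: "i \<in> D \<Longrightarrow> x \<in> T \<Longrightarrow> a \<le> norm (\<phi>' i x)"
    and hoelder: "i \<in> D \<Longrightarrow> x \<in> T \<Longrightarrow> y \<in> T \<Longrightarrow>
      \<bar>norm (\<phi>' i x) - norm (\<phi>' i y)\<bar> \<le> c * norm (x - y) powr \<alpha>"
    and dist_le: "x \<in> T \<Longrightarrow> y \<in> T \<Longrightarrow> dist x y \<le> \<Delta>"
    and X_nbhd: "x \<in> X \<Longrightarrow> cball x \<rho> \<subseteq> T"
    and compact_X: "compact X" and self_similar: "X = (\<Union>i\<in>D. \<phi> i ` X)"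
    and x0: "x0 \<in> X" and y0: "y0 \<in> X" and x0_neq_y0: "x0 \<noteq> y0"
begin

lemma X_sub_T: "x \<in> X \<Longrightarrow> x \<in> T"
  using X_nbhd \<rho> by fastforce

lemma x0_T: "x0 \<in> T"
  using X_sub_T x0 by blast

lemma \<Delta>_pos: "0 < \<Delta>"
proof -
  have "0 < dist x0 y0" using x0_neq_y0 by simp
  also have "\<dots> \<le> \<Delta>" using X_sub_T x0 y0 by (intro dist_le) auto
  finally show ?thesis .
qed

lemma alphabet_nonempty: "D \<noteq> {}"
  using self_similar x0 by auto

lemma word_map_T: "I \<in> lists D \<Longrightarrow> x \<in> T \<Longrightarrow> word_map \<phi> I x \<in> T"
  by (induction I) (auto intro: maps_into)

lemma word_map_X: "I \<in> lists D \<Longrightarrow> x \<in> X \<Longrightarrow> word_map \<phi> I x \<in> X"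
proof (induction I)
  case (Cons i I)
  then have "\<phi> i (word_map \<phi> I x) \<in> (\<Union>i\<in>D. \<phi> i ` X)" by auto
  then show ?case using self_similar by simp
qed simp

lemma word_map_contracts:
  "I \<in> lists D \<Longrightarrow> x \<in> T \<Longrightarrow> y \<in> T \<Longrightarrow> dist (word_map \<phi> I x) (word_map \<phi> I y) \<le> r ^ length I * dist x y"
proof (induction I)
  case (Cons i I)
  have "dist (word_map \<phi> (i # I) x) (word_map \<phi> (i # I) y) \<le> r * dist (word_map \<phi> I x) (word_map \<phi> I y)"
    using Cons.prems by (auto intro!: lipschitz word_map_T)
  also have "\<dots> \<le> r * (r ^ length I * dist x y)"
    using Cons r by (intro mult_left_mono Cons.IH) auto
  finally show ?case by (simp add: mult_ac)
qed simp

lemma inj_word_map: "I \<in> lists D \<Longrightarrow> inj_on (word_map \<phi> I) T"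
proof (induction I)
  case (Cons i I)
  then have "inj_on (\<phi> i \<circ> word_map \<phi> I) T"
    using word_map_T inj_maps[of i] by (intro comp_inj_on) (auto intro: inj_on_subset)
  then show ?case by (simp add: comp_def)
qed simp

primrec derivative_norm :: "'i list \<Rightarrow> 'a \<Rightarrow> real" where
  "derivative_norm [] x = 1"
| "derivative_norm (i # I) x = norm (\<phi>' i (word_map \<phi> I x)) * derivative_norm I x"

lemma derivative_norm_append:
  "derivative_norm (I @ J) x = derivative_norm I (word_map \<phi> J x) * derivative_norm J x"
  by (induction I) auto

lemma derivative_norm_ge: "I \<in> lists D \<Longrightarrow> x \<in> T \<Longrightarrow> a ^ length I \<le> derivative_norm I x"
proof (induction I)
  case (Cons i I)
  then have "a * a ^ length I \<le> norm (\<phi>' i (word_map \<phi> I x)) * derivative_norm I x"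
    using a word_map_T by (intro mult_mono derivative_ge) auto
  then show ?case by simp
qed simp

lemma derivative_norm_pos: "I \<in> lists D \<Longrightarrow> x \<in> T \<Longrightarrow> 0 < derivative_norm I x"
  using derivative_norm_ge[of I x] a by (meson less_le_trans zero_less_power)

lemma word_map_derivative:
  "I \<in> lists D \<Longrightarrow> x \<in> T \<Longrightarrow>
    \<exists>A. (word_map \<phi> I has_derivative A) (at x) \<and> (\<forall>v. norm (A v) = derivative_norm I x * norm v)"
proof (induction I)
  case Nil
  show ?case by (intro exI[of _ id]) (auto simp: id_def has_derivative_ident)
next
  case (Cons i I)
  then obtain A where A: "(word_map \<phi> I has_derivative A) (at x)" "\<And>v. norm (A v) = derivative_norm I x * norm v"
    by auto
  have i: "i \<in> D" and I: "I \<in> lists D" using Cons.prems by auto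
  have wT: "word_map \<phi> I x \<in> T" using I Cons.prems(2) by (rule word_map_T)
  have "(\<phi> i \<circ> word_map \<phi> I has_derivative blinfun_apply (\<phi>' i (word_map \<phi> I x)) \<circ> A) (at x)"
    by (rule diff_chain_at[OF A(1) derivative[OF i wT]])
  then show ?case
    using A(2) conformal[OF i wT]
    by (intro exI[of _ "blinfun_apply (\<phi>' i (word_map \<phi> I x)) \<circ> A"]) (auto simp: comp_def)
qed

definition K :: real where
  "K = exp (c / a * \<Delta> powr \<alpha> / (1 - r powr \<alpha>))"

lemma r_powr: "0 < r powr \<alpha>" "r powr \<alpha> < 1"
  using r \<alpha> powr_less_mono2[of \<alpha> r 1] by auto

lemma K_ge_one: "1 \<le> K"
  unfolding K_def using r_powr a c \<Delta>_pos by simp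

text \<open>
  Two orbits under the same word approach each other geometrically, so by the Hoelder condition the
  logarithms of the derivatives along them differ by a convergent geometric series, whose sum
  defines \<open>K\<close>. The estimate compares points in different components of \<open>T\<close> as well, because contraction and Hoelder
  condition are in terms of the Euclidean distance.
\<close>

lemma bounded_distortion:
  assumes "I \<in> lists D" "x \<in> T" "y \<in> T"
  shows "derivative_norm I x \<le> K * derivative_norm I y"
proof -
  let ?q = "r powr \<alpha>"
  let ?E = "\<lambda>n. exp (c / a * \<Delta> powr \<alpha> * (\<Sum>k<n. ?q ^ k))"
  have "derivative_norm L x \<le> ?E (length L) * derivative_norm L y" if "L \<in> lists D" for L
    using that
  proof (induction L rule: list.induct)
    case (Cons i I)
    let ?u = "word_map \<phi> I x" and ?v = "word_map \<phi> I y"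
    have L: "i # I \<in> lists D" by (rule Cons.prems)
    have i: "i \<in> D" using L by simp
    have I: "I \<in> lists D" using L by simp
    have T: "?u \<in> T" "?v \<in> T" using word_map_T[OF I] assms(2,3) by blast+
    have "norm (?u - ?v) \<le> r ^ length I * \<Delta>"
    proof -
      have "norm (?u - ?v) \<le> r ^ length I * dist x y"
        using word_map_contracts[OF I assms(2,3)] by (simp add: dist_norm)
      also have "\<dots> \<le> r ^ length I * \<Delta>"
        using dist_le[OF assms(2,3)] r by (intro mult_left_mono) auto
      finally show ?thesis .
    qed
    then have "norm (?u - ?v) powr \<alpha> \<le> (r ^ length I * \<Delta>) powr \<alpha>"
      using \<alpha> by (intro powr_mono2) auto
    also have "\<dots> = ?q ^ length I * \<Delta> powr \<alpha>"
      using r \<Delta>_pos by (simp add: powr_mult powr_realpow[symmetric] powr_powr mult.commute)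
    finally have dist: "norm (?u - ?v) powr \<alpha> \<le> ?q ^ length I * \<Delta> powr \<alpha>" .
    define \<epsilon> where "\<epsilon> = c / a * (?q ^ length I * \<Delta> powr \<alpha>)"
    have \<epsilon>: "0 \<le> \<epsilon>" using a c by (simp add: \<epsilon>_def)
    have "norm (\<phi>' i ?u) \<le> norm (\<phi>' i ?v) + c * norm (?u - ?v) powr \<alpha>"
      using hoelder[OF i T] by linarith
    also have "\<dots> \<le> norm (\<phi>' i ?v) + a * \<epsilon>"
      using mult_left_mono[OF dist, of c] a c by (simp add: \<epsilon>_def)
    also have "\<dots> \<le> norm (\<phi>' i ?v) * (1 + \<epsilon>)"
      using mult_right_mono[OF derivative_ge[OF i T(2)] \<epsilon>] by (simp add: algebra_simps)
    also have "\<dots> \<le> norm (\<phi>' i ?v) * exp \<epsilon>"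
      by (intro mult_left_mono exp_ge_add_one_self) auto
    finally have "norm (\<phi>' i ?u) * derivative_norm I x
        \<le> (norm (\<phi>' i ?v) * exp \<epsilon>) * (?E (length I) * derivative_norm I y)"
      using Cons.IH I derivative_norm_pos[OF I assms(2)] by (intro mult_mono) auto
    also have "exp \<epsilon> * ?E (length I) = ?E (length (i # I))"
      by (simp add: exp_add[symmetric] \<epsilon>_def algebra_simps)
    then have "(norm (\<phi>' i ?v) * exp \<epsilon>) * (?E (length I) * derivative_norm I y)
        = ?E (length (i # I)) * derivative_norm (i # I) y"
      by (simp add: mult_ac)
    finally show ?case by simp
  qed simp
  then have "derivative_norm I x \<le> ?E (length I) * derivative_norm I y" using assms(1) .
  also have "\<dots> \<le> K * derivative_norm I y"
  proof (rule mult_right_mono)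
    have "(\<Sum>k<length I. ?q ^ k) \<le> 1 / (1 - ?q)"
      using r_powr by (simp add: sum_gp_strict divide_right_mono)
    then have "c / a * \<Delta> powr \<alpha> * (\<Sum>k<length I. ?q ^ k) \<le> c / a * \<Delta> powr \<alpha> * (1 / (1 - ?q))"
      using a c by (intro mult_left_mono) auto
    then show "?E (length I) \<le> K" by (simp add: K_def)
  qed (use derivative_norm_pos[OF assms(1,3)] in simp)
  finally show ?thesis .
qed

text \<open>
  By bounded distortion the choice of the base point \<open>x0\<close> matters only up to the factor \<open>K\<close>.
\<close>

definition \<Lambda> :: "'i list \<Rightarrow> real" where
  "\<Lambda> I = derivative_norm I x0"

lemma derivative_norm_le_weight: "I \<in> lists D \<Longrightarrow> x \<in> T \<Longrightarrow> derivative_norm I x \<le> K * \<Lambda> I"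
  unfolding \<Lambda>_def by (intro bounded_distortion x0_T)

lemma weight_le_derivative_norm: "I \<in> lists D \<Longrightarrow> x \<in> T \<Longrightarrow> \<Lambda> I / K \<le> derivative_norm I x"
  using bounded_distortion[OF _ x0_T, of I x] K_ge_one by (simp add: \<Lambda>_def field_simps)

sublocale word_weights D \<Lambda> K a
proof
  show "finite D" "D \<noteq> {}" "1 \<le> K" "0 < a"
    using finite_alphabet alphabet_nonempty K_ge_one a by auto
  show "\<Lambda> [] = 1" by (simp add: \<Lambda>_def)
  show "0 < \<Lambda> I" if "I \<in> lists D" for I
    unfolding \<Lambda>_def using that x0_T by (rule derivative_norm_pos)
  show "a \<le> \<Lambda> [i]" if "i \<in> D" for i
    unfolding \<Lambda>_def using derivative_norm_ge[of "[i]" x0] that x0_T by simp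
  fix I J assume IJ: "I \<in> lists D" "J \<in> lists D"
  have J: "word_map \<phi> J x0 \<in> T" "0 < \<Lambda> J"
    using IJ x0_T word_map_T derivative_norm_pos by (auto simp: \<Lambda>_def)
  have "\<Lambda> (I @ J) = derivative_norm I (word_map \<phi> J x0) * \<Lambda> J"
    by (simp add: \<Lambda>_def derivative_norm_append)
  moreover have "derivative_norm I (word_map \<phi> J x0) * \<Lambda> J \<le> (K * \<Lambda> I) * \<Lambda> J"
    using derivative_norm_le_weight[OF IJ(1) J(1)] J(2) by (intro mult_right_mono) auto
  moreover have "\<Lambda> I * \<Lambda> J \<le> (K * derivative_norm I (word_map \<phi> J x0)) * \<Lambda> J"
    using bounded_distortion[OF IJ(1) x0_T J(1)] J(2)
    by (intro mult_right_mono) (auto simp: \<Lambda>_def)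
  ultimately show "\<Lambda> (I @ J) \<le> K * \<Lambda> I * \<Lambda> J" "\<Lambda> I * \<Lambda> J \<le> K * \<Lambda> (I @ J)"
    by (simp_all add: mult.assoc)
qed

lemma weight_ge_power: "I \<in> lists D \<Longrightarrow> a ^ length I \<le> \<Lambda> I"
  unfolding \<Lambda>_def using x0_T by (intro derivative_norm_ge)

lemma ball_subset_word_image:
  assumes I: "I \<in> lists D" and \<delta>: "0 < \<delta>" "cball x \<delta> \<subseteq> T"
  shows "ball (word_map \<phi> I x) (\<Lambda> I / K * \<delta>) \<subseteq> word_map \<phi> I ` ball x \<delta>"
proof -
  have "\<forall>p\<in>T. \<exists>A. (word_map \<phi> I has_derivative A) (at p) \<and> (\<forall>v. norm (A v) = derivative_norm I p * norm v)"
    using word_map_derivative[OF I] by blast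
  then obtain A where A: "\<And>p. p \<in> T \<Longrightarrow> (word_map \<phi> I has_derivative A p) (at p)"
    "\<And>p v. p \<in> T \<Longrightarrow> norm (A p v) = derivative_norm I p * norm v" by metis
  show ?thesis
  proof (rule ball_subset_image_of_expanding_derivative[OF \<delta>(1)])
    fix p assume "p \<in> cball x \<delta>"
    then have p: "p \<in> T" using \<delta>(2) by blast
    show "(word_map \<phi> I has_derivative A p) (at p)" by (rule A(1)[OF p])
    fix v
    have lin: "linear (A p)" using A(1)[OF p] by (rule has_derivative_linear)
    have pos: "0 < derivative_norm I p" by (rule derivative_norm_pos[OF I p])
    have "inj (A p)"
    proof (subst linear_injective_0[OF lin], intro allI impI)
      fix v assume "A p v = 0"
      then show "v = 0" using A(2)[OF p, of v] pos by simp
    qed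
    then have "surj (A p)" by (rule linear_injective_imp_surjective[OF lin]) simp
    then obtain u where u: "A p u = v" by (metis surjD)
    have "\<Lambda> I / K * norm u \<le> derivative_norm I p * norm u"
      using weight_le_derivative_norm[OF I p] by (rule mult_right_mono) simp
    also have "\<dots> = norm v" using A(2)[OF p, of u] u by simp
    finally show "\<exists>u. A p u = v \<and> \<Lambda> I / K * norm u \<le> norm v" using u by blast
  qed
qed

lemma word_map_lipschitz_nearby:
  assumes I: "I \<in> lists D" and y: "y \<in> X" and x: "dist x y \<le> \<rho>"
  shows "dist (word_map \<phi> I x) (word_map \<phi> I y) \<le> K * \<Lambda> I * dist x y"
proof -
  have "\<forall>p\<in>T. \<exists>A. (word_map \<phi> I has_derivative A) (at p) \<and> (\<forall>v. norm (A v) = derivative_norm I p * norm v)"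
    using word_map_derivative[OF I] by blast
  then obtain A where A: "\<And>p. p \<in> T \<Longrightarrow> (word_map \<phi> I has_derivative A p) (at p)"
    "\<And>p v. p \<in> T \<Longrightarrow> norm (A p v) = derivative_norm I p * norm v" by metis
  have B: "cball y \<rho> \<subseteq> T" using X_nbhd[OF y] .
  have "norm (word_map \<phi> I x - word_map \<phi> I y) \<le> K * \<Lambda> I * norm (x - y)"
  proof (rule differentiable_bound[of "cball y \<rho>" "word_map \<phi> I" A])
    fix p assume "p \<in> cball y \<rho>"
    then have p: "p \<in> T" using B by blast
    show "(word_map \<phi> I has_derivative A p) (at p within cball y \<rho>)"
      using A(1)[OF p] by (rule has_derivative_at_withinI)
    show "onorm (A p) \<le> K * \<Lambda> I"
    proof (rule onorm_le)
      fix v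
      show "norm (A p v) \<le> K * \<Lambda> I * norm v"
        using A(2)[OF p] derivative_norm_le_weight[OF I p] by (simp add: mult_right_mono)
    qed
  qed (use x \<rho> in \<open>auto simp: dist_commute\<close>)
  then show ?thesis by (simp add: dist_norm)
qed

text \<open>
  The mean value inequality requires a segment inside \<open>T\<close>, which two distant points need not have. After the last \<open>m\<close>
  letters of the word have been applied, however, all images are closer than \<open>\<rho>\<close>, and the remaining letters act
  through a ball around a point of \<open>X\<close>. These \<open>m\<close> letters cost a bounded factor, as do words
  shorter than \<open>m\<close>.
\<close>

lemma word_map_lipschitz:
  obtains M where "0 < M"
    "\<And>I x y. I \<in> lists D \<Longrightarrow> x \<in> T \<Longrightarrow> y \<in> X \<Longrightarrow>
      dist (word_map \<phi> I x) (word_map \<phi> I y) \<le> M * \<Lambda> I * dist x y"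
proof -
  have "(\<lambda>n. r ^ n * \<Delta>) \<longlonglongrightarrow> 0 * \<Delta>"
    using r by (intro tendsto_intros LIMSEQ_power_zero) auto
  then have "\<forall>\<^sub>F n in sequentially. r ^ n * \<Delta> < \<rho>"
    using \<rho> by (intro order_tendstoD(2)) auto
  then obtain m where m: "r ^ m * \<Delta> < \<rho>" using eventually_happens'[OF sequentially_bot] by blast
  define M where "M = K\<^sup>2 / a ^ m"
  have M: "0 < M" using K_ge_one a by (simp add: M_def)
  moreover have "dist (word_map \<phi> I x) (word_map \<phi> I y) \<le> M * \<Lambda> I * dist x y"
    if I: "I \<in> lists D" and x: "x \<in> T" and y: "y \<in> X" for I x y
  proof (cases "m \<le> length I")
    case True
    define I1 where "I1 = take (length I - m) I"
    define I2 where "I2 = drop (length I - m) I"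
    have split: "I = I1 @ I2" by (simp add: I1_def I2_def)
    have len: "length I2 = m" using True by (simp add: I2_def)
    have l: "I1 \<in> lists D" "I2 \<in> lists D" using I split by auto
    have d2: "dist (word_map \<phi> I2 x) (word_map \<phi> I2 y) \<le> r ^ m * dist x y"
      using word_map_contracts[OF l(2) x X_sub_T[OF y]] len by simp
    also have "\<dots> \<le> r ^ m * \<Delta>" using dist_le[OF x X_sub_T[OF y]] r by (intro mult_left_mono) auto
    finally have near: "dist (word_map \<phi> I2 x) (word_map \<phi> I2 y) \<le> \<rho>" using m by simp
    have "r ^ m * dist x y \<le> 1 * dist x y" using r by (intro mult_right_mono power_le_one) auto
    then have d1: "dist (word_map \<phi> I2 x) (word_map \<phi> I2 y) \<le> dist x y" using d2 by simp
    have "a ^ m * \<Lambda> I1 \<le> \<Lambda> I2 * \<Lambda> I1"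
      using weight_ge_power[OF l(2)] len weight_pos[OF l(1)] by (intro mult_right_mono) auto
    also have "\<dots> \<le> K * \<Lambda> I" using weight_append_ge[OF l] split by (simp add: mult.commute)
    finally have w: "\<Lambda> I1 \<le> K * \<Lambda> I / a ^ m" using a by (simp add: field_simps)
    have "dist (word_map \<phi> I x) (word_map \<phi> I y) \<le> K * \<Lambda> I1 * dist (word_map \<phi> I2 x) (word_map \<phi> I2 y)"
      using word_map_lipschitz_nearby[OF l(1) word_map_X[OF l(2) y] near] by (simp add: split)
    also have "\<dots> \<le> K * (K * \<Lambda> I / a ^ m) * dist x y"
      using w d1 K_ge_one weight_pos[OF l(1)] weight_pos[OF I] a
      by (intro mult_mono mult_left_mono) auto
    also have "\<dots> = M * \<Lambda> I * dist x y" by (simp add: M_def power2_eq_square)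
    finally show ?thesis .
  next
    case False
    have "a ^ m \<le> a ^ length I" using False a by (intro power_decreasing) auto
    also have "\<dots> \<le> \<Lambda> I" by (rule weight_ge_power[OF I])
    finally have "a ^ m \<le> 1 * \<Lambda> I" by simp
    also have "\<dots> \<le> K\<^sup>2 * \<Lambda> I"
      using one_le_power[OF K_ge_one, of 2] weight_pos[OF I] by (intro mult_right_mono) auto
    finally have "a ^ m \<le> K\<^sup>2 * \<Lambda> I" .
    then have "1 \<le> M * \<Lambda> I" using a by (simp add: M_def field_simps)
    then have "1 * dist x y \<le> M * \<Lambda> I * dist x y" by (intro mult_right_mono) auto
    moreover have "r ^ length I * dist x y \<le> 1 * dist x y"
      using r by (intro mult_right_mono power_le_one) auto
    ultimately show ?thesis using word_map_contracts[OF I x X_sub_T[OF y]] by linarith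
  qed
  ultimately show thesis by (rule that)
qed

text \<open>
  The image of a small ball around \<open>x0\<close> that misses \<open>y0\<close> contains a ball of radius comparable with
  \<open>\<Lambda> I\<close>, and by injectivity \<open>y0\<close> is sent outside of that ball.
\<close>

lemma cylinder_dist_ge:
  obtains b where "0 < b"
    "\<And>I. I \<in> lists D \<Longrightarrow> b * \<Lambda> I \<le> dist (word_map \<phi> I x0) (word_map \<phi> I y0)"
proof -
  define \<delta> where "\<delta> = min \<rho> (dist x0 y0)"
  have \<delta>: "0 < \<delta>" "\<delta> \<le> dist x0 y0" using \<rho> x0_neq_y0 by (auto simp: \<delta>_def)
  have sub: "cball x0 \<delta> \<subseteq> T" using X_nbhd[OF x0] by (auto simp: \<delta>_def)
  have "\<delta> / K * \<Lambda> I \<le> dist (word_map \<phi> I x0) (word_map \<phi> I y0)" if I: "I \<in> lists D" for I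
  proof (rule ccontr)
    assume "\<not> ?thesis"
    then have "word_map \<phi> I y0 \<in> ball (word_map \<phi> I x0) (\<Lambda> I / K * \<delta>)" by (simp add: mult.commute)
    then obtain p where p: "p \<in> ball x0 \<delta>" "word_map \<phi> I y0 = word_map \<phi> I p"
      using ball_subset_word_image[OF I \<delta>(1) sub] by blast
    have "p \<in> T" using p(1) sub by auto
    then have "y0 = p" using inj_onD[OF inj_word_map[OF I] p(2)] X_sub_T[OF y0] by blast
    then show False using p(1) \<delta>(2) by simp
  qed
  moreover have "0 < \<delta> / K" using \<delta> K_ge_one by simp
  ultimately show thesis using that by blast
qed

text \<open>
  Two points whose images are at distance at least a multiple of \<open>\<Lambda> I\<close> are contracted by \<open>r\<close> at every letter.
\<close>

lemma weight_decay:
  obtains B where "0 < B" "\<And>I. I \<in> lists D \<Longrightarrow> \<Lambda> I \<le> B * r ^ length I"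
proof -
  obtain b where b: "0 < b" "\<And>I. I \<in> lists D \<Longrightarrow> b * \<Lambda> I \<le> dist (word_map \<phi> I x0) (word_map \<phi> I y0)"
    using cylinder_dist_ge by metis
  have "\<Lambda> I \<le> (dist x0 y0 / b) * r ^ length I" if I: "I \<in> lists D" for I
  proof -
    have "b * \<Lambda> I \<le> r ^ length I * dist x0 y0"
      using b(2)[OF I] word_map_contracts[OF I x0_T X_sub_T[OF y0]] by linarith
    then show ?thesis using b(1) by (simp add: field_simps)
  qed
  moreover have "0 < dist x0 y0 / b" using b x0_neq_y0 by simp
  ultimately show thesis using that by blast
qed

lemma bounded_cylinder: "I \<in> lists D \<Longrightarrow> bounded (word_map \<phi> I ` X)"
  using word_map_X compact_X by (meson bounded_subset compact_imp_bounded image_subsetI)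

lemma cylinder_diameter_le:
  obtains M where "0 < M" "\<And>I. I \<in> lists D \<Longrightarrow> diameter (word_map \<phi> I ` X) \<le> M * \<Lambda> I"
proof -
  obtain M where M: "0 < M" "\<And>I x y. I \<in> lists D \<Longrightarrow> x \<in> T \<Longrightarrow> y \<in> X \<Longrightarrow>
      dist (word_map \<phi> I x) (word_map \<phi> I y) \<le> M * \<Lambda> I * dist x y"
    using word_map_lipschitz by metis
  have "diameter (word_map \<phi> I ` X) \<le> (M * \<Delta>) * \<Lambda> I" if I: "I \<in> lists D" for I
  proof (rule diameter_le)
    show "word_map \<phi> I ` X \<noteq> {} \<or> 0 \<le> M * \<Delta> * \<Lambda> I" using x0 by auto
    fix u v assume "u \<in> word_map \<phi> I ` X" "v \<in> word_map \<phi> I ` X"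
    then obtain x y where xy: "x \<in> X" "y \<in> X" "u = word_map \<phi> I x" "v = word_map \<phi> I y" by blast
    have "dist u v \<le> M * \<Lambda> I * dist x y" using M(2)[OF I X_sub_T[OF xy(1)] xy(2)] xy by simp
    also have "\<dots> \<le> M * \<Lambda> I * \<Delta>"
      using M(1) weight_pos[OF I] dist_le[OF xy(1,2)[THEN X_sub_T]] by (intro mult_left_mono) auto
    finally show "norm (u - v) \<le> M * \<Delta> * \<Lambda> I" by (simp add: dist_norm mult_ac)
  qed
  moreover have "0 < M * \<Delta>" using M(1) \<Delta>_pos by simp
  ultimately show thesis using that by blast
qed

lemma cylinder_diameter_ge:
  obtains b where "0 < b" "\<And>I. I \<in> lists D \<Longrightarrow> b * \<Lambda> I \<le> diameter (word_map \<phi> I ` X)"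
proof -
  obtain b where b: "0 < b" "\<And>I. I \<in> lists D \<Longrightarrow> b * \<Lambda> I \<le> dist (word_map \<phi> I x0) (word_map \<phi> I y0)"
    using cylinder_dist_ge by metis
  have "b * \<Lambda> I \<le> diameter (word_map \<phi> I ` X)" if I: "I \<in> lists D" for I
    using b(2)[OF I] diameter_bounded_bound[OF bounded_cylinder[OF I], of "word_map \<phi> I x0" "word_map \<phi> I y0"]
      x0 y0 by simp
  then show thesis using that b(1) by blast
qed

lemma cylinder_refine:
  assumes "x \<in> X"
  shows "\<exists>J\<in>words n. x \<in> word_map \<phi> J ` X"
  using assms
proof (induction n arbitrary: x)
  case (Suc n)
  have "x \<in> (\<Union>i\<in>D. \<phi> i ` X)" by (subst self_similar[symmetric]) (rule Suc.prems)
  then obtain i x' where i: "i \<in> D" "x' \<in> X" "x = \<phi> i x'" by blast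
  then obtain J where "J \<in> words n" "x' \<in> word_map \<phi> J ` X" using Suc.IH by blast
  then have "i # J \<in> words (Suc n)" "x \<in> word_map \<phi> (i # J) ` X"
    using i by (auto simp: words_def)
  then show ?case by blast
qed simp

lemma cylinder_append:
  assumes "x \<in> word_map \<phi> I ` X"
  shows "\<exists>J\<in>words n. x \<in> word_map \<phi> (I @ J) ` X"
proof -
  obtain x' where x': "x' \<in> X" "x = word_map \<phi> I x'" using assms by blast
  then obtain J where "J \<in> words n" "x' \<in> word_map \<phi> J ` X" using cylinder_refine by blast
  then show ?thesis using x' by auto
qed

lemma long_words_light:
  assumes "0 < d"
  obtains n0 where "\<And>I. I \<in> lists D \<Longrightarrow> n0 \<le> length I \<Longrightarrow> \<Lambda> I < d"
proof -
  obtain B where B: "0 < B" "\<And>I. I \<in> lists D \<Longrightarrow> \<Lambda> I \<le> B * r ^ length I" using weight_decay by metis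
  have "(\<lambda>n. B * r ^ n) \<longlonglongrightarrow> B * 0"
    using r by (intro tendsto_intros LIMSEQ_power_zero) auto
  then have "\<forall>\<^sub>F n in sequentially. B * r ^ n < d"
    using assms by (intro order_tendstoD(2)) auto
  then obtain n0 where "\<And>n. n0 \<le> n \<Longrightarrow> B * r ^ n < d" unfolding eventually_sequentially by blast
  then show thesis using that B(2) by (meson le_less_trans)
qed

lemma stopping_cylinder:
  assumes x: "x \<in> X" and d: "0 < d"
  obtains J where "J \<in> stopping_words d" "x \<in> word_map \<phi> J ` X"
proof -
  obtain n0 where n0: "\<And>I. I \<in> lists D \<Longrightarrow> n0 \<le> length I \<Longrightarrow> \<Lambda> I < d" using long_words_light[OF d] by blast
  obtain I where I: "I \<in> words n0" "x \<in> word_map \<phi> I ` X" using cylinder_refine[OF x] by blast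
  then have "I \<in> lists D" "\<Lambda> I < d" using n0 by (auto simp: words_def)
  then obtain J J' where J: "I = J @ J'" "J \<in> stopping_words d" by (rule stopping_prefix)
  have "J' \<in> lists D" using J(1) I(1) by (auto simp: words_def)
  then have "x \<in> word_map \<phi> J ` X" using I(2) J(1) word_map_X by auto
  then show thesis using that J(2) by blast
qed

end

section \<open>Pressure and dimension under the open set condition\<close>

context conformal_system
begin

lemma null_if_light_cylinder_covers:
  assumes s: "0 < s"
    and cov: "\<And>e. 0 < e \<Longrightarrow> \<exists>F. finite F \<and> F \<subseteq> lists D \<and> A \<subseteq> (\<Union>I\<in>F. word_map \<phi> I ` X) \<and>
      (\<Sum>I\<in>F. \<Lambda> I powr s) \<le> e"
  shows "hausdorff_measure s A = 0"
proof (rule hausdorff_null_if_finite_covers[OF s, where W = "\<lambda>I. word_map \<phi> I ` X"])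
  obtain M where M: "0 < M" "\<And>I. I \<in> lists D \<Longrightarrow> diameter (word_map \<phi> I ` X) \<le> M * \<Lambda> I"
    using cylinder_diameter_le by metis
  fix e :: real assume e: "0 < e"
  have "0 < e / M powr s" using e M(1) by simp
  from cov[OF this] obtain F where F: "finite F" "F \<subseteq> lists D" "A \<subseteq> (\<Union>I\<in>F. word_map \<phi> I ` X)"
    "(\<Sum>I\<in>F. \<Lambda> I powr s) \<le> e / M powr s" by blast
  have "(\<Sum>I\<in>F. diameter (word_map \<phi> I ` X) powr s) \<le> (\<Sum>I\<in>F. M powr s * \<Lambda> I powr s)"
  proof (rule sum_mono)
    fix I assume "I \<in> F"
    then have I: "I \<in> lists D" using F(2) by blast
    have "diameter (word_map \<phi> I ` X) powr s \<le> (M * \<Lambda> I) powr s"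
      using M(2)[OF I] s diameter_ge_0[OF bounded_cylinder[OF I]] by (intro powr_mono2) auto
    then show "diameter (word_map \<phi> I ` X) powr s \<le> M powr s * \<Lambda> I powr s"
      using M(1) weight_pos[OF I] by (simp add: powr_mult)
  qed
  also have "\<dots> = M powr s * (\<Sum>I\<in>F. \<Lambda> I powr s)" by (simp add: sum_distrib_left)
  also have "\<dots> \<le> e" using F(4) M(1) by (simp add: field_simps)
  finally show "\<exists>F. finite F \<and> A \<subseteq> (\<Union>I\<in>F. word_map \<phi> I ` X) \<and>
      (\<forall>I\<in>F. bounded (word_map \<phi> I ` X)) \<and> (\<Sum>I\<in>F. diameter (word_map \<phi> I ` X) powr s) \<le> e"
    using F(1,3) bounded_cylinder[OF subsetD[OF F(2)]] by blast
qed

lemma null_if_pressure_sum_small: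
  assumes s: "0 < s" and small: "\<And>e. 0 < e \<Longrightarrow> \<exists>n. pressure_sum s n \<le> e"
  shows "hausdorff_measure s X = 0"
proof (rule null_if_light_cylinder_covers[OF s])
  fix e :: real assume "0 < e"
  then obtain n where n: "pressure_sum s n \<le> e" using small by blast
  have "words n \<subseteq> lists D" using words_lists by blast
  moreover have "X \<subseteq> (\<Union>I\<in>words n. word_map \<phi> I ` X)"
  proof
    fix x assume "x \<in> X"
    then show "x \<in> (\<Union>I\<in>words n. word_map \<phi> I ` X)" using cylinder_refine[of x n] by blast
  qed
  moreover have "(\<Sum>I\<in>words n. \<Lambda> I powr s) \<le> e" using n unfolding pressure_sum_def .
  ultimately show "\<exists>F. finite F \<and> F \<subseteq> lists D \<and> X \<subseteq> (\<Union>I\<in>F. word_map \<phi> I ` X) \<and>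
      (\<Sum>I\<in>F. \<Lambda> I powr s) \<le> e" by (intro exI[of _ "words n"] conjI finite_words)
qed

text \<open>
  The infimum that defines the Hausdorff dimension is over a non-empty set: for a large exponent the weights of the words of
  length \<open>n\<close> decay faster than their number grows.
\<close>

lemma ex_null_exponent: "\<exists>t>0. hausdorff_measure t X = 0"
proof -
  have D: "0 < card D" using finite_D D_nonempty by (simp add: card_gt_0_iff)
  obtain k where k: "r ^ k < 1 / (2 * real (card D))"
    using real_arch_pow_inv[of "1 / (2 * real (card D))" r] r D by auto
  have "k \<noteq> 0"
  proof
    assume "k = 0"
    then have "1 < 1 / (2 * real (card D))" using k by simp
    then have "2 * real (card D) < 1" using D by (simp add: field_simps)
    then show False using D by simp
  qed
  define t where "t = real k"
  have t: "0 < t" using \<open>k \<noteq> 0\<close> by (simp add: t_def)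
  obtain B where B: "0 < B" "\<And>I. I \<in> lists D \<Longrightarrow> \<Lambda> I \<le> B * r ^ length I" using weight_decay by metis
  have rt: "(r ^ n) powr t = (r ^ k) ^ n" for n
    using r by (simp add: t_def powr_realpow power_mult[symmetric] mult.commute)
  have bound: "pressure_sum t n \<le> B powr t * (1/2) ^ n" for n
  proof -
    have "pressure_sum t n \<le> (\<Sum>I\<in>words n. B powr t * (r ^ k) ^ n)"
      unfolding pressure_sum_def
    proof (rule sum_mono)
      fix I assume I: "I \<in> words n"
      then have "\<Lambda> I powr t \<le> (B * r ^ n) powr t"
        using B(2)[of I] weight_pos[of I] t by (intro powr_mono2) (auto simp: words_def)
      then show "\<Lambda> I powr t \<le> B powr t * (r ^ k) ^ n"
        using B(1) r by (simp add: powr_mult rt)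
    qed
    also have "\<dots> = B powr t * (real (card D) * r ^ k) ^ n"
      by (simp add: card_words power_mult_distrib)
    also have "\<dots> \<le> B powr t * (1/2) ^ n"
      using k D r by (intro mult_left_mono power_mono) (auto simp: field_simps)
    finally show ?thesis .
  qed
  have "hausdorff_measure t X = 0"
  proof (rule null_if_pressure_sum_small[OF t])
    fix e :: real assume "0 < e"
    then obtain n where "(1/2) ^ n < e / B powr t"
      using real_arch_pow_inv[of "e / B powr t" "1/2"] B(1) by auto
    then have "B powr t * (1/2) ^ n \<le> e" using B(1) by (simp add: field_simps)
    then show "\<exists>n. pressure_sum t n \<le> e" using bound order_trans by blast
  qed
  then show ?thesis using t by blast
qed

end

text \<open>
  The open set condition, with the open set cut down so that it lies in \<open>T\<close>, and with a ball in it.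
  It may be disjoint from the attractor.
\<close>

locale osc_conformal_system = conformal_system +
  fixes U :: "'b set" and u0 :: 'b and \<eta> :: real
  assumes U_sub: "U \<subseteq> T"
    and U_into: "i \<in> D \<Longrightarrow> x \<in> U \<Longrightarrow> \<phi> i x \<in> U"
    and U_disjoint: "i \<in> D \<Longrightarrow> j \<in> D \<Longrightarrow> i \<noteq> j \<Longrightarrow> \<phi> i ` U \<inter> \<phi> j ` U = {}"
    and \<eta>: "0 < \<eta>" and u0: "cball u0 \<eta> \<subseteq> U"
begin

lemma word_map_U: "I \<in> lists D \<Longrightarrow> x \<in> U \<Longrightarrow> word_map \<phi> I x \<in> U"
  by (induction I) (auto intro: U_into)

lemma parallel_images_disjoint:
  "I \<in> lists D \<Longrightarrow> J \<in> lists D \<Longrightarrow> I \<parallel> J \<Longrightarrow> word_map \<phi> I ` U \<inter> word_map \<phi> J ` U = {}"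
proof (induction I arbitrary: J)
  case (Cons i I)
  then obtain j J' where J: "J = j # J'" by (cases J) auto
  have ij: "i \<in> D" "j \<in> D" "I \<in> lists D" "J' \<in> lists D" using Cons.prems J by auto
  show ?case
  proof (cases "i = j")
    case False
    have "word_map \<phi> (i # I) ` U \<subseteq> \<phi> i ` U" "word_map \<phi> J ` U \<subseteq> \<phi> j ` U"
      using ij word_map_U J by auto
    then show ?thesis using U_disjoint[OF ij(1,2) False] by blast
  next
    case True
    then have "I \<parallel> J'" using Cons.prems(3) J by (auto simp: parallel_def)
    then have "word_map \<phi> I ` U \<inter> word_map \<phi> J' ` U = {}" using Cons.IH ij by blast
    moreover have "word_map \<phi> I ` U \<subseteq> T" "word_map \<phi> J' ` U \<subseteq> T"
      using word_map_U ij U_sub by auto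
    ultimately have "\<phi> i ` (word_map \<phi> I ` U) \<inter> \<phi> i ` (word_map \<phi> J' ` U) = {}"
      using inj_on_image_Int[OF inj_maps[OF ij(1)], of "word_map \<phi> I ` U" "word_map \<phi> J' ` U"] by simp
    then show ?thesis by (simp add: J True image_image)
  qed
qed (auto simp: parallel_def)

text \<open>
  Every stopping word \<open>J\<close> at scale \<open>d\<close> owns a ball of radius \<open>\<beta> d\<close> inside the image of \<open>U\<close>. These balls are
  disjoint, because stopping words are pairwise incomparable, and they lie within distance \<open>R d\<close> of \<open>p\<close>, because
  images of \<open>u0\<close> and of \<open>X\<close> under \<open>J\<close> are at distance comparable with \<open>\<Lambda> J < d\<close>. Comparing volumes bounds their number.
\<close>

lemma few_stopping_cylinders_near_ball:
  obtains N where "0 < N"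
    "\<And>d p F. 0 < d \<Longrightarrow> d \<le> 1 \<Longrightarrow> finite F \<Longrightarrow> F \<subseteq> stopping_words d \<Longrightarrow>
      (\<And>J. J \<in> F \<Longrightarrow> word_map \<phi> J ` X \<inter> ball p d \<noteq> {}) \<Longrightarrow> real (card F) \<le> N"
proof -
  obtain M where M: "0 < M" "\<And>I x y. I \<in> lists D \<Longrightarrow> x \<in> T \<Longrightarrow> y \<in> X \<Longrightarrow>
      dist (word_map \<phi> I x) (word_map \<phi> I y) \<le> M * \<Lambda> I * dist x y"
    using word_map_lipschitz by metis
  define \<beta> where "\<beta> = a / K / K * \<eta>"
  define R where "R = 1 + M * \<Delta> + \<beta>"
  have \<beta>: "0 < \<beta>" using a_pos K_ge_1 \<eta> by (simp add: \<beta>_def)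
  have R: "0 < R" using M(1) \<Delta>_pos \<beta> by (simp add: R_def add_pos_pos)
  have u0U: "u0 \<in> U" using u0 \<eta> by auto
  have "real (card F) \<le> (R / \<beta>) ^ DIM('b)"
    if d: "0 < d" "d \<le> 1" and F: "finite F" "F \<subseteq> stopping_words d"
      and meets: "\<And>J. J \<in> F \<Longrightarrow> word_map \<phi> J ` X \<inter> ball p d \<noteq> {}" for d p F
  proof -
    let ?B = "\<lambda>J. ball (word_map \<phi> J u0) (\<beta> * d)"
    have inU: "?B J \<subseteq> word_map \<phi> J ` U" if "J \<in> F" for J
    proof -
      have J: "J \<in> stopping_words d" "J \<in> lists D" using that F(2) stopping_words_lists by auto
      have "\<beta> * d \<le> \<Lambda> J / K * \<eta>"
        using stopping_words_butlast(4)[OF J(1) d(2)] K_ge_1 \<eta> by (simp add: \<beta>_def field_simps)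
      then have "?B J \<subseteq> ball (word_map \<phi> J u0) (\<Lambda> J / K * \<eta>)" by (rule subset_ball)
      also have "\<dots> \<subseteq> word_map \<phi> J ` ball u0 \<eta>"
        using u0 U_sub by (intro ball_subset_word_image[OF J(2) \<eta>]) auto
      also have "\<dots> \<subseteq> word_map \<phi> J ` U" using u0 by (intro image_mono) (auto simp: subset_eq)
      finally show ?thesis .
    qed
    have near: "?B J \<subseteq> ball p (R * d)" if JF: "J \<in> F" for J
    proof
      fix y assume y: "y \<in> ?B J"
      have J: "J \<in> stopping_words d" "J \<in> lists D" using JF F(2) stopping_words_lists by auto
      obtain x where x: "x \<in> X" "dist p (word_map \<phi> J x) < d" using meets[OF JF] by auto
      have "dist (word_map \<phi> J u0) (word_map \<phi> J x) \<le> M * \<Lambda> J * dist u0 x"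
        using u0U U_sub by (intro M(2)[OF J(2) _ x(1)]) auto
      also have "\<dots> \<le> M * d * \<Delta>"
        using M(1) stopping_words_less[OF J(1)] weight_pos[OF J(2)] dist_le[of u0 x] u0U U_sub X_sub_T[OF x(1)] d(1)
        by (intro mult_mono) auto
      finally have "dist (word_map \<phi> J u0) (word_map \<phi> J x) \<le> M * d * \<Delta>" .
      moreover have "dist p y \<le> dist p (word_map \<phi> J x) + dist (word_map \<phi> J u0) (word_map \<phi> J x) + dist (word_map \<phi> J u0) y"
        by metric
      moreover have "dist (word_map \<phi> J u0) y < \<beta> * d" using y by simp
      ultimately have "dist p y < d + M * d * \<Delta> + \<beta> * d" using x(2) by linarith
      then show "y \<in> ball p (R * d)" by (simp add: R_def algebra_simps)
    qed
    have disj: "pairwise (\<lambda>I J. disjnt (?B I) (?B J)) F"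
      unfolding pairwise_def
    proof (intro ballI impI)
      fix I J assume IJ: "I \<in> F" "J \<in> F" "I \<noteq> J"
      then have "I \<parallel> J" using F(2) stopping_words_parallel by blast
      then have "word_map \<phi> I ` U \<inter> word_map \<phi> J ` U = {}"
        using IJ F(2) stopping_words_lists by (intro parallel_images_disjoint) auto
      then show "disjnt (?B I) (?B J)" using inU[OF IJ(1)] inU[OF IJ(2)] by (auto simp: disjnt_def)
    qed
    define \<omega> where "\<omega> = unit_ball_vol (real DIM('b))"
    have \<omega>: "0 < \<omega>" by (simp add: \<omega>_def)
    have "real (card F) * (\<omega> * (\<beta> * d) ^ DIM('b)) = (\<Sum>J\<in>F. measure lebesgue (?B J))"
      using \<beta> d by (simp add: content_ball \<omega>_def)
    also have "\<dots> = measure lebesgue (\<Union>J\<in>F. ?B J)"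
      using F(1) disj by (intro measure_UNION'[symmetric]) auto
    also have "\<dots> \<le> measure lebesgue (ball p (R * d))"
    proof (rule measure_mono_fmeasurable)
      show "(\<Union>J\<in>F. ?B J) \<subseteq> ball p (R * d)" using near by blast
      show "(\<Union>J\<in>F. ?B J) \<in> sets lebesgue" using F(1) by (intro sets.finite_UN) auto
    qed simp
    also have "\<dots> = \<omega> * (R * d) ^ DIM('b)"
      using R d by (simp add: content_ball \<omega>_def)
    finally have "real (card F) * (\<beta> * d) ^ DIM('b) \<le> (R * d) ^ DIM('b)"
      using \<omega> by (simp add: mult.left_commute)
    then have "real (card F) * \<beta> ^ DIM('b) \<le> R ^ DIM('b)"
      using d by (simp add: power_mult_distrib mult.assoc[symmetric])
    then show ?thesis using \<beta> by (simp add: power_divide field_simps)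
  qed
  moreover have "0 < (R / \<beta>) ^ DIM('b)" using R \<beta> by simp
  ultimately show thesis using that by blast
qed

text \<open>
  The mass distribution principle in finite form. Given a cover of \<open>X\<close> by finitely many balls of radii \<open>d n\<close>, every
  long word has a prefix that is a stopping word at one of these scales and whose cylinder meets the corresponding
  ball. Each such prefix carries at most the fraction \<open>Q d(n)\<^sup>t\<close> of the total mass, since the lower
  bound on the pressure sums controls the masses of all shorter tails, and there are boundedly many of them for each ball.
  So \<open>\<Sum> d(n)\<^sup>t\<close> cannot be small.
\<close>

lemma positive_measure_if_pressure_sum_ge:
  assumes t: "0 < t" and b: "0 < b" "\<And>n. b \<le> pressure_sum t n"
  shows "hausdorff_measure t X \<noteq> 0"
proof
  assume null: "hausdorff_measure t X = 0"
  obtain N where N: "0 < N" "\<And>d p F. 0 < d \<Longrightarrow> d \<le> 1 \<Longrightarrow> finite F \<Longrightarrow> F \<subseteq> stopping_words d \<Longrightarrow>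
      (\<And>J. J \<in> F \<Longrightarrow> word_map \<phi> J ` X \<inter> ball p d \<noteq> {}) \<Longrightarrow> real (card F) \<le> N"
    using few_stopping_cylinders_near_ball by metis
  define Q where "Q = (K powr t)\<^sup>2 / b"
  have Kt: "0 < K powr t" using K_ge_1 by simp
  then have Q: "0 < Q" using b by (simp add: Q_def)
  define e where "e = min 1 (1 / (2 * Q * N))"
  have e: "0 < e" using Q N(1) by (simp add: e_def)
  obtain p :: "nat \<Rightarrow> 'b" and d :: "nat \<Rightarrow> real" where cover: "X \<subseteq> (\<Union>n. ball (p n) (d n))"
    and d_pos: "\<forall>n. d n > 0" and d_sum: "\<forall>F. finite F \<longrightarrow> (\<Sum>n\<in>F. d n powr t) \<le> e"
    by (rule hausdorff_null_ball_cover[OF null t e])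
  have d1: "d n \<le> 1" for n
  proof (rule ccontr)
    assume "\<not> d n \<le> 1"
    then have "1 < d n powr t" using t by (simp add: gr_one_powr)
    moreover have "d n powr t \<le> e" using d_sum[rule_format, of "{n}"] by simp
    ultimately show False by (simp add: e_def)
  qed
  obtain F where F: "finite F" "X \<subseteq> (\<Union>n\<in>F. ball (p n) (d n))"
    using compactE_image[OF compact_X, of UNIV "\<lambda>n. ball (p n) (d n)"] cover by auto
  define \<delta> where "\<delta> = Min (insert 1 (d ` F))"
  have \<delta>: "0 < \<delta>" "\<And>n. n \<in> F \<Longrightarrow> \<delta> \<le> d n" using F(1) d_pos by (auto simp: \<delta>_def)
  obtain L where L: "\<And>I. I \<in> lists D \<Longrightarrow> L \<le> length I \<Longrightarrow> \<Lambda> I < \<delta>" using long_words_light[OF \<delta>(1)] by blast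
  define G where "G n = {J \<in> stopping_words (d n). length J \<le> L \<and> word_map \<phi> J ` X \<inter> ball (p n) (d n) \<noteq> {}}" for n
  have finG: "finite (G n)" for n
  proof (rule finite_subset)
    show "G n \<subseteq> (\<Union>k\<in>{..L}. words k)" using stopping_words_lists by (auto simp: G_def words_def)
  qed auto
  define Y where "Y = Sigma F (\<lambda>n. Sigma (G n) (\<lambda>J. words (L - length J)))"
  have "pressure_sum t L \<le> (\<Sum>y\<in>Y. \<Lambda> (fst (snd y) @ snd (snd y)) powr t)"
    unfolding pressure_sum_def
  proof (rule sum_le_included[where i = "\<lambda>y. fst (snd y) @ snd (snd y)"])
    show "finite Y" unfolding Y_def using F(1) finG by (intro finite_SigmaI) auto
    show "\<forall>I\<in>words L. \<exists>y\<in>Y. fst (snd y) @ snd (snd y) = I \<and> \<Lambda> I powr t \<le> \<Lambda> (fst (snd y) @ snd (snd y)) powr t"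
    proof
      fix I assume I: "I \<in> words L"
      then have Il: "I \<in> lists D" "length I = L" by (auto simp: words_def)
      have xX: "word_map \<phi> I x0 \<in> X" by (rule word_map_X[OF Il(1) x0])
      then obtain n where n: "n \<in> F" "word_map \<phi> I x0 \<in> ball (p n) (d n)" using F(2) by blast
      have "\<Lambda> I < d n" using L[OF Il(1)] Il(2) \<delta>(2)[OF n(1)] by fastforce
      then obtain J J' where J: "I = J @ J'" "J \<in> stopping_words (d n)" using stopping_prefix[OF Il(1)] by metis
      have J': "J' \<in> words (L - length J)" using J(1) I by (auto simp: words_def)
      have "word_map \<phi> I x0 \<in> word_map \<phi> J ` X"
        using J(1) J' word_map_X[of J' x0] x0 words_lists by auto
      then have "J \<in> G n" using J n Il(2) by (auto simp: G_def)
      then have "(n, J, J') \<in> Y" using n(1) J' by (simp add: Y_def)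
      then show "\<exists>y\<in>Y. fst (snd y) @ snd (snd y) = I \<and> \<Lambda> I powr t \<le> \<Lambda> (fst (snd y) @ snd (snd y)) powr t"
        using J(1) by force
    qed
  qed auto
  also have "\<dots> = (\<Sum>n\<in>F. \<Sum>J\<in>G n. mass_below t (L - length J) J)"
  proof -
    let ?Z = "\<lambda>n. Sigma (G n) (\<lambda>J. words (L - length J))"
    have "(\<Sum>J\<in>G n. mass_below t (L - length J) J) = (\<Sum>z\<in>?Z n. \<Lambda> (fst z @ snd z) powr t)" for n
      unfolding mass_below_def using finG by (subst sum.Sigma) (auto simp: case_prod_unfold)
    moreover have "(\<Sum>n\<in>F. \<Sum>z\<in>?Z n. \<Lambda> (fst z @ snd z) powr t) = (\<Sum>y\<in>Y. \<Lambda> (fst (snd y) @ snd (snd y)) powr t)"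
      unfolding Y_def using F(1) finG by (subst sum.Sigma) (auto simp: case_prod_unfold)
    ultimately show ?thesis by simp
  qed
  also have "\<dots> \<le> (\<Sum>n\<in>F. \<Sum>J\<in>G n. Q * pressure_sum t L * d n powr t)"
  proof (intro sum_mono)
    fix n J assume n: "n \<in> F" and J: "J \<in> G n"
    have Jl: "J \<in> lists D" "length J \<le> L" "\<Lambda> J < d n"
      using J stopping_words_lists stopping_words_less by (auto simp: G_def)
    have "b * pressure_sum t (L - length J) \<le> pressure_sum t (length J) * pressure_sum t (L - length J)"
      using b(2) pressure_sum_pos[of t "L - length J"] by (intro mult_right_mono) auto
    also have "\<dots> \<le> K powr t * pressure_sum t L"
      using pressure_sum_add_ge[of t "length J" "L - length J"] t Jl(2) by simp
    finally have tail: "pressure_sum t (L - length J) \<le> K powr t * pressure_sum t L / b"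
      using b(1) by (simp add: field_simps)
    have "mass_below t (L - length J) J \<le> K powr t * \<Lambda> J powr t * pressure_sum t (L - length J)"
      using t Jl(1) by (intro mass_below_le) auto
    also have "\<dots> \<le> K powr t * d n powr t * (K powr t * pressure_sum t L / b)"
      using tail Kt t Jl(3) weight_pos[OF Jl(1)] pressure_sum_pos[of t "L - length J"]
      by (intro mult_mono mult_left_mono powr_mono2) auto
    also have "\<dots> = Q * pressure_sum t L * d n powr t" by (simp add: Q_def power2_eq_square)
    finally show "mass_below t (L - length J) J \<le> Q * pressure_sum t L * d n powr t" .
  qed
  also have "\<dots> = (\<Sum>n\<in>F. real (card (G n)) * (Q * pressure_sum t L * d n powr t))" by simp
  also have "\<dots> \<le> (\<Sum>n\<in>F. N * (Q * pressure_sum t L * d n powr t))"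
  proof (intro sum_mono mult_right_mono)
    fix n
    show "real (card (G n)) \<le> N"
      using d_pos d1 finG by (intro N(2)[of "d n" _ "p n"]) (auto simp: G_def)
    show "0 \<le> Q * pressure_sum t L * d n powr t" using Q pressure_sum_pos[of t L] by simp
  qed
  also have "\<dots> = N * Q * pressure_sum t L * (\<Sum>n\<in>F. d n powr t)"
    unfolding sum_distrib_left by (intro sum.cong) (auto simp: mult_ac)
  also have "\<dots> \<le> N * Q * pressure_sum t L * (1 / (2 * Q * N))"
    using d_sum[rule_format, OF F(1)] N(1) Q pressure_sum_pos[of t L] by (intro mult_left_mono) (auto simp: e_def)
  also have "\<dots> = pressure_sum t L / 2" using N(1) Q by (simp add: field_simps)
  finally show False using pressure_sum_pos[of t L] by simp
qed

text \<open>
  A larger sum would persist at an exponent above the dimension and give \<open>X\<close> positive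
  measure there.
\<close>

lemma pressure_sum_le_at_dimension:
  assumes "0 \<le> hausdorff_dim X"
  shows "pressure_sum (hausdorff_dim X) n \<le> K powr hausdorff_dim X"
proof (rule ccontr)
  assume "\<not> ?thesis"
  then have "K powr hausdorff_dim X < pressure_sum (hausdorff_dim X) n" by simp
  then obtain t b where t: "hausdorff_dim X < t" "0 < b" "\<And>n. b \<le> pressure_sum t n"
    by (rule pressure_sum_exceeds_at_larger_exponent[OF assms]) blast
  obtain t0 where "0 < t0" "hausdorff_measure t0 X = 0" using ex_null_exponent by blast
  then have "hausdorff_measure t X = 0" using hausdorff_null_above_dim[of t0 X t] t(1) by simp
  moreover have "hausdorff_measure t X \<noteq> 0"
    using assms t by (intro positive_measure_if_pressure_sum_ge[of t b]) auto
  ultimately show False by simp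
qed

end

section \<open>Shrinking targets and the limsup set\<close>

text \<open>
  The inverse of the step length \<open>A ln n\<close> is the density of the sequence near \<open>n\<close>, so the sum behaves like the
  integral of \<open>1 / (n ln n)\<close>, which is \<open>ln (ln n)\<close>. Starting at \<open>3\<close>, just above \<open>exp 1\<close>, keeps both logarithms
  meaningful.
\<close>

lemma sum_inverse_unbounded_if_log_steps:
  fixes N :: "nat \<Rightarrow> nat"
  assumes A: "0 < A" and N0: "3 \<le> N 0" and incr: "\<And>t. N t < N (Suc t)"
    and step: "\<And>t. real (N (Suc t)) \<le> real (N t) + A * ln (real (N t))"
  shows "\<exists>t. R \<le> (\<Sum>j<t. 1 / real (N j))"
proof -
  have ge: "3 + t \<le> N t" for t
  proof (induction t)
    case (Suc t)
    then show ?case using incr[of t] by simp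
  qed (use N0 in simp)
  have ln1: "1 \<le> ln (real (N t))" for t
  proof -
    have "exp 1 \<le> real (N t)" using exp_le ge[of t] by linarith
    then show ?thesis using ge[of t] by (subst ln_ge_iff) auto
  qed
  have lnln: "ln (ln (real (N t))) \<le> ln (ln (real (N 0))) + A * (\<Sum>j<t. 1 / real (N j))" for t
  proof (induction t)
    case (Suc t)
    let ?n = "real (N t)"
    have n: "0 < ?n" using ge[of t] by simp
    have l: "1 \<le> ln ?n" by (rule ln1)
    then have l0: "0 < ln ?n" by linarith
    have "?n * (1 + A * ln ?n / ?n) = ?n + A * ln ?n" using n by (simp add: distrib_left)
    then have "real (N (Suc t)) \<le> ?n * (1 + A * ln ?n / ?n)" using step[of t] by simp
    then have "ln (real (N (Suc t))) \<le> ln (?n * (1 + A * ln ?n / ?n))"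
      using ge[of "Suc t"] by (intro ln_mono) auto
    also have "\<dots> = ln ?n + ln (1 + A * ln ?n / ?n)"
      using n l A by (intro ln_mult_pos) (auto simp: add_pos_nonneg)
    also have "\<dots> \<le> ln ?n + A * ln ?n / ?n"
      using n l A by (intro add_left_mono ln_add_one_self_le_self) auto
    also have "\<dots> = ln ?n * (1 + A / ?n)" using n by (simp add: field_simps)
    finally have "ln (ln (real (N (Suc t)))) \<le> ln (ln ?n * (1 + A / ?n))"
      using ln1[of "Suc t"] by (intro ln_mono) auto
    also have "\<dots> = ln (ln ?n) + ln (1 + A / ?n)"
      using n A by (intro ln_mult_pos l0) (auto simp: add_pos_nonneg)
    also have "\<dots> \<le> ln (ln ?n) + A / ?n"
      using n A by (intro add_left_mono ln_add_one_self_le_self) auto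
    finally show ?case using Suc.IH by (simp add: algebra_simps)
  qed simp
  define B where "B = ln (ln (real (N 0))) + A * R"
  obtain t where t: "exp (exp B) \<le> real t" using real_arch_simple by blast
  have "exp (exp B) \<le> real (N t)" using t ge[of t] by linarith
  then have "exp B \<le> ln (real (N t))" using ge[of t] by (subst ln_ge_iff) auto
  then have "B \<le> ln (ln (real (N t)))" using ln1[of t] by (subst ln_ge_iff) auto
  then have "A * R \<le> A * (\<Sum>j<t. 1 / real (N j))" using lnln[of t] by (simp add: B_def)
  then show ?thesis using A by auto
qed

context osc_conformal_system
begin

lemma stopping_word_length_le:
  assumes \<epsilon>: "0 < \<epsilon>" "\<epsilon> \<le> 1" and s: "0 < s"
  obtains A where "0 < A"
    "\<And>n J. 3 \<le> n \<Longrightarrow> J \<in> stopping_words (\<epsilon> * real n powr (- 1 / s)) \<Longrightarrow> real (length J) \<le> A * ln (real n)"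
proof -
  obtain B where B: "0 < B" "\<And>I. I \<in> lists D \<Longrightarrow> \<Lambda> I \<le> B * r ^ length I" using weight_decay by metis
  define \<kappa> where "\<kappa> = - ln r"
  have \<kappa>: "0 < \<kappa>" using r by (simp add: \<kappa>_def)
  define A where "A = 1 + (\<bar>ln (B / \<epsilon>)\<bar> + 1 / s) / \<kappa>"
  have "0 < A" using \<kappa> s by (simp add: A_def add_pos_nonneg)
  moreover have "real (length J) \<le> A * ln (real n)"
    if n: "3 \<le> n" and J: "J \<in> stopping_words (\<epsilon> * real n powr (- 1 / s))" for n J
  proof -
    let ?d = "\<epsilon> * real n powr (- 1 / s)"
    have n0: "0 < real n" using n by simp
    have "exp 1 \<le> real n" using exp_le n by linarith
    then have ln1: "1 \<le> ln (real n)" using n0 by (subst ln_ge_iff) auto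
    have d: "0 < ?d" using \<epsilon> n by simp
    have "real n powr (- 1 / s) \<le> 1"
      using n s powr_mono[of "- 1 / s" 0 "real n"] by simp
    then have "?d \<le> 1" using mult_mono[of \<epsilon> 1 "real n powr (- 1 / s)" 1] \<epsilon> by simp
    note J' = stopping_words_butlast[OF J this]
    define k where "k = length (butlast J)"
    have len: "real (length J) = 1 + real k" using J'(1) by (simp add: k_def Suc_leI)
    have "?d \<le> B * r ^ k" using J'(3) B(2)[OF J'(2)] by (simp add: k_def)
    then have "ln ?d \<le> ln (B * r ^ k)" using d by (intro ln_mono)
    also have "\<dots> = ln B + real k * ln r" using B(1) r by (simp add: ln_mult_pos ln_realpow)
    finally have "real k * \<kappa> \<le> ln B - ln ?d" by (simp add: \<kappa>_def)
    also have "\<dots> = ln (B / \<epsilon>) + ln (real n) / s"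
      using B(1) \<epsilon> n0 by (simp add: ln_mult_pos ln_div ln_powr)
    also have "\<dots> \<le> \<bar>ln (B / \<epsilon>)\<bar> * ln (real n) + ln (real n) / s"
      using mult_left_mono[OF ln1, of "\<bar>ln (B / \<epsilon>)\<bar>"] by simp
    finally have "real k \<le> (\<bar>ln (B / \<epsilon>)\<bar> + 1 / s) / \<kappa> * ln (real n)"
      using \<kappa> by (simp add: field_simps)
    then show ?thesis using len ln1 by (simp add: A_def distrib_right)
  qed
  ultimately show thesis using that by blast
qed

text \<open>
  A point whose coding contains the word \<open>W n\<close> at position \<open>n\<close> is a hit for the prefix of length \<open>n\<close>. Points
  without hits beyond the level \<open>N0\<close> therefore lie in cylinders of survivors, and the mass of
  these tends to zero.
\<close>

lemma eventually_missing_points_null: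
  assumes s: "s = hausdorff_dim X" "0 < s" and z: "z \<in> X" and C: "0 < C"
    and \<theta>: "\<And>n. 1 \<le> n \<Longrightarrow> inverse C * real n powr (- 1 / s) \<le> \<theta> n"
    and N0: "3 \<le> N0"
  shows "hausdorff_measure s {x \<in> X. \<forall>I\<in>lists D. N0 \<le> length I \<longrightarrow>
    x \<notin> cball (word_map \<phi> I z) (diameter (word_map \<phi> I ` X) * \<theta> (length I))} = 0"
    (is "hausdorff_measure s ?Bad = 0")
proof (cases "\<forall>e>0. \<exists>n. pressure_sum s n \<le> e")
  case True
  then have "hausdorff_measure s X = 0" using s(2) by (intro null_if_pressure_sum_small) auto
  then show ?thesis by (rule hausdorff_null_subset[OF s(2)]) auto
next
  case False
  then obtain m where m: "0 < m" "\<And>n. m \<le> pressure_sum s n" by (meson linear not_less order_less_imp_le)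
  have upper: "pressure_sum s n \<le> K powr s" for n
    using pressure_sum_le_at_dimension s by simp
  obtain M where M: "0 < M" "\<And>I. I \<in> lists D \<Longrightarrow> diameter (word_map \<phi> I ` X) \<le> M * \<Lambda> I"
    using cylinder_diameter_le by metis
  obtain b where b: "0 < b" "\<And>I. I \<in> lists D \<Longrightarrow> b * \<Lambda> I \<le> diameter (word_map \<phi> I ` X)"
    using cylinder_diameter_ge by metis
  \<comment> \<open>Chosen so that the diameter of the cylinder of \<open>I @ W n\<close>, at most \<open>M K \<Lambda> I d(n)\<close>, is
    at most \<open>b \<Lambda> I / C\<close> times \<open>n\<close> to the power \<open>-1/s\<close>.\<close>
  define \<epsilon> where "\<epsilon> = min 1 (b / (C * M * K))"
  have \<epsilon>: "0 < \<epsilon>" "\<epsilon> \<le> 1" using b C M K_ge_1 by (auto simp: \<epsilon>_def)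
  define d where "d n = \<epsilon> * real n powr (- 1 / s)" for n
  have d: "0 < d n" if "1 \<le> n" for n using \<epsilon> that by (simp add: d_def)
  have "\<forall>n. \<exists>J. 1 \<le> n \<longrightarrow> J \<in> stopping_words (d n) \<and> z \<in> word_map \<phi> J ` X"
    using stopping_cylinder[OF z d] by metis
  then obtain W where W: "\<And>n. 1 \<le> n \<Longrightarrow> W n \<in> stopping_words (d n)"
    "\<And>n. 1 \<le> n \<Longrightarrow> z \<in> word_map \<phi> (W n) ` X" by metis
  obtain A where A: "0 < A" "\<And>n J. 3 \<le> n \<Longrightarrow> J \<in> stopping_words (\<epsilon> * real n powr (- 1 / s)) \<Longrightarrow>
      real (length J) \<le> A * ln (real n)"
    using stopping_word_length_le[OF \<epsilon> s(2)] by metis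
  have d1: "d n \<le> 1" if n: "1 \<le> n" for n
  proof -
    have "real n powr (- 1 / s) \<le> 1"
      using n s(2) powr_mono[of "- 1 / s" 0 "real n"] by simp
    then show ?thesis using mult_mono[of \<epsilon> 1 "real n powr (- 1 / s)" 1] \<epsilon> by (simp add: d_def)
  qed
  define N where "N = rec_nat N0 (\<lambda>_ n. n + length (W n))"
  have N_0: "N 0 = N0" and N_Suc: "N (Suc t) = N t + length (W (N t))" for t
    by (simp_all add: N_def)
  have N3: "3 \<le> N t" for t by (induction t) (use N0 N_0 N_Suc in auto)
  have N1: "1 \<le> N t" for t using N3[of t] by simp
  have NN0: "N0 \<le> N t" for t by (induction t) (use N_0 N_Suc in auto)
  define J where "J t = W (N t)" for t
  have Jl: "J t \<in> lists D" for t using stopping_words_lists[OF W(1)[OF N1[of t]]] unfolding J_def .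
  have NJ: "N (Suc t) = N t + length (J t)" for t by (simp add: N_Suc J_def)
  define q where "q = m / (K powr s * (K powr s) ^ 3)"
  have q: "0 < q" using m K_ge_1 by (simp add: q_def)
  define c2 where "c2 = (a / K * \<epsilon>) powr s"
  have c2: "0 < c2" using a_pos K_ge_1 \<epsilon> by (simp add: c2_def)
  have weight: "c2 / real (N t) \<le> \<Lambda> (J t) powr s" for t
  proof -
    have "c2 / real (N t) = (a / K * d (N t)) powr s"
      using a_pos K_ge_1 \<epsilon> N1[of t] s(2)
      by (simp add: c2_def d_def powr_mult powr_divide powr_powr powr_minus field_simps)
    also have "\<dots> \<le> \<Lambda> (J t) powr s"
      using stopping_words_butlast(4)[OF W(1)[OF N1[of t]] d1[OF N1[of t]]] d[OF N1[of t]] a_pos K_ge_1 s(2)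
      by (intro powr_mono2) (auto simp: J_def)
    finally show ?thesis .
  qed
  have hit: "x \<notin> ?Bad" if I: "I \<in> lists D" "length I = N t" and x: "x \<in> word_map \<phi> (I @ J t) ` X" for x I t
  proof -
    let ?n = "N t"
    have IJ: "I @ J t \<in> lists D" using I Jl by simp
    obtain z' where z': "z' \<in> X" "z = word_map \<phi> (J t) z'" using W(2)[OF N1[of t]] by (auto simp: J_def)
    have "word_map \<phi> I z \<in> word_map \<phi> (I @ J t) ` X" using z' by auto
    then have "dist (word_map \<phi> I z) x \<le> diameter (word_map \<phi> (I @ J t) ` X)"
      using x by (intro diameter_bounded_bound bounded_cylinder[OF IJ])
    also have "\<dots> \<le> M * \<Lambda> (I @ J t)" by (rule M(2)[OF IJ])
    also have "\<dots> \<le> M * (K * \<Lambda> I * \<Lambda> (J t))"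
      using M(1) weight_append_le[OF I(1) Jl] by (intro mult_left_mono) auto
    also have "\<dots> \<le> M * (K * \<Lambda> I * d ?n)"
      using M(1) K_ge_1 weight_pos[OF I(1)] stopping_words_less[OF W(1)[OF N1[of t]]]
      by (intro mult_left_mono) (auto simp: J_def)
    also have "\<dots> = (M * K * \<epsilon>) * \<Lambda> I * real ?n powr (- 1 / s)" by (simp add: d_def mult_ac)
    also have "\<dots> \<le> (b * inverse C) * \<Lambda> I * real ?n powr (- 1 / s)"
    proof (intro mult_right_mono)
      have "M * K * \<epsilon> \<le> M * K * (b / (C * M * K))"
        using M(1) K_ge_1 by (intro mult_left_mono) (auto simp: \<epsilon>_def)
      also have "\<dots> = b * inverse C" using M(1) K_ge_1 C by (simp add: field_simps)
      finally show "M * K * \<epsilon> \<le> b * inverse C" .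
    qed (use weight_pos[OF I(1)] in auto)
    also have "\<dots> = (b * \<Lambda> I) * (inverse C * real ?n powr (- 1 / s))" by (simp add: mult_ac)
    also have "\<dots> \<le> diameter (word_map \<phi> I ` X) * \<theta> ?n"
      using b C weight_pos[OF I(1)] diameter_ge_0[OF bounded_cylinder[OF I(1)]]
      by (intro mult_mono b(2)[OF I(1)] \<theta>[OF N1]) auto
    finally have "x \<in> cball (word_map \<phi> I z) (diameter (word_map \<phi> I ` X) * \<theta> (length I))"
      using I(2) by simp
    moreover have "N0 \<le> length I" using I(2) NN0[of t] by simp
    ultimately show ?thesis using I(1) by blast
  qed
  let ?S = "survivors (words (N 0)) J"
  have sub: "?S t \<subseteq> words (N t)" for t
    using Jl NJ by (rule survivors_words[of J N])
  have cover: "?Bad \<subseteq> (\<Union>I\<in>?S t. word_map \<phi> I ` X)" for t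
  proof (induction t)
    case 0
    show ?case using cylinder_refine[of _ "N 0"] by auto
  next
    case (Suc t)
    show ?case
    proof
      fix x assume x: "x \<in> ?Bad"
      then obtain I where I: "I \<in> ?S t" "x \<in> word_map \<phi> I ` X" using Suc.IH by blast
      then have Iw: "I \<in> lists D" "length I = N t" using sub[of t] by (auto simp: words_def)
      obtain J' where J': "J' \<in> words (length (J t))" "x \<in> word_map \<phi> (I @ J') ` X"
        using cylinder_append[OF I(2)] by blast
      have "J' \<noteq> J t" using hit[OF Iw] J'(2) x by blast
      then have "I @ J' \<in> ?S (Suc t)" using I(1) J'(1) by force
      then show "x \<in> (\<Union>I\<in>?S (Suc t). word_map \<phi> I ` X)" using J'(2) by blast
    qed
  qed
  show ?thesis
  proof (rule null_if_light_cylinder_covers[OF s(2)])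
    fix e :: real assume e: "0 < e"
    define R where "R = ln (K powr s / e) / (q * c2)"
    have steps: "real (N (Suc t)) \<le> real (N t) + A * ln (real (N t))" for t
      using A(2)[OF N3[of t]] W(1)[OF N1[of t]] by (simp add: N_Suc d_def)
    have incr: "N t < N (Suc t)" for t
      using stopping_words_butlast(1)[OF W(1)[OF N1[of t]] d1[OF N1[of t]]] by (simp add: N_Suc)
    have "\<exists>t. R \<le> (\<Sum>j<t. 1 / real (N j))"
      using A(1) N3[of 0] incr steps by (rule sum_inverse_unbounded_if_log_steps)
    then obtain t where t: "R \<le> (\<Sum>j<t. 1 / real (N j))" by blast
    have "q * (c2 * R) \<le> q * (\<Sum>j<t. \<Lambda> (J j) powr s)"
    proof (rule mult_left_mono)
      have "c2 * R \<le> c2 * (\<Sum>j<t. 1 / real (N j))" using t c2 by (intro mult_left_mono) auto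
      also have "\<dots> = (\<Sum>j<t. c2 / real (N j))" by (simp add: sum_distrib_left)
      also have "\<dots> \<le> (\<Sum>j<t. \<Lambda> (J j) powr s)" by (intro sum_mono weight)
      finally show "c2 * R \<le> (\<Sum>j<t. \<Lambda> (J j) powr s)" .
    qed (use q in simp)
    then have "ln (K powr s / e) \<le> q * (\<Sum>j<t. \<Lambda> (J j) powr s)"
      using q c2 by (simp add: R_def)
    then have "exp (- q * (\<Sum>j<t. \<Lambda> (J j) powr s)) \<le> exp (- ln (K powr s / e))" by simp
    also have "\<dots> = e / K powr s" using e K_ge_1 by (simp add: exp_minus)
    finally have small: "K powr s * exp (- q * (\<Sum>j<t. \<Lambda> (J j) powr s)) \<le> e"
      using K_ge_1 by (simp add: field_simps)
    have "(\<Sum>I\<in>?S t. \<Lambda> I powr s) \<le> K powr s * exp (- q * (\<Sum>j<t. \<Lambda> (J j) powr s))"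
      unfolding q_def using s(2) by (intro survivors_mass_le[of s J N] Jl NJ m upper) auto
    then have "(\<Sum>I\<in>?S t. \<Lambda> I powr s) \<le> e" using small by linarith
    moreover have "finite (?S t)" using sub finite_words by (rule finite_subset)
    moreover have "?S t \<subseteq> lists D" using sub[of t] words_lists by blast
    ultimately show "\<exists>F. finite F \<and> F \<subseteq> lists D \<and> ?Bad \<subseteq> (\<Union>I\<in>F. word_map \<phi> I ` X) \<and>
        (\<Sum>I\<in>F. \<Lambda> I powr s) \<le> e"
      using cover[of t] by (intro exI[of _ "?S t"] conjI)
  qed
qed

text \<open>
  There are finitely many words of each length, so a point outside the limsup set misses all balls beyond some level.
\<close>

lemma limsup_set_full_measure:
  assumes dim: "0 < hausdorff_dim X" and z: "z \<in> X" and C: "0 < C"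
    and \<theta>: "\<And>n. 1 \<le> n \<Longrightarrow> inverse C * real n powr (- 1 / hausdorff_dim X) \<le> \<theta> n"
  shows "hausdorff_measure (hausdorff_dim X) (X - limsup_set D \<phi> X \<theta> z) = 0"
proof -
  let ?hit = "\<lambda>x I. x \<in> cball (word_map \<phi> I z) (diameter (word_map \<phi> I ` X) * \<theta> (length I))"
  let ?Bad = "\<lambda>k. {x \<in> X. \<forall>I\<in>lists D. 3 + k \<le> length I \<longrightarrow> \<not> ?hit x I}"
  have "hausdorff_measure (hausdorff_dim X) (?Bad k) = 0" for k
    by (rule eventually_missing_points_null[OF refl dim z C \<theta>]) auto
  then have null: "hausdorff_measure (hausdorff_dim X) (\<Union>k. ?Bad k) = 0"
    by (rule hausdorff_null_UN[OF dim])
  show ?thesis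
  proof (rule hausdorff_null_subset[OF dim null], rule subsetI)
    fix x assume x: "x \<in> X - limsup_set D \<phi> X \<theta> z"
    let ?H = "{I \<in> lists D. I \<noteq> [] \<and> ?hit x I}"
    have "finite ?H" using x by (simp add: limsup_set_def)
    then have "finite (length ` ?H)" by (rule finite_imageI)
    then obtain k where k: "\<And>I. I \<in> ?H \<Longrightarrow> length I < k" by (auto simp: finite_nat_set_iff_bounded)
    have "\<not> ?hit x I" if I: "I \<in> lists D" "3 + k \<le> length I" for I
    proof
      assume "?hit x I"
      moreover have "I \<noteq> []" using I(2) by auto
      ultimately have "I \<in> ?H" using I(1) by blast
      then show False using k I(2) by fastforce
    qed
    then have "x \<in> ?Bad k" using x by blast
    then show "x \<in> (\<Union>k. ?Bad k)" by blast
  qed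
qed

end

theorem corollary1p7:
  fixes D :: "'i set"
    and \<phi> :: "'i \<Rightarrow> 'a::euclidean_space \<Rightarrow> 'a"
    and X Y V :: "'a set"
    and z :: 'a
    and \<theta> :: "nat \<Rightarrow> real"
  assumes "conformal_ifs D \<phi> Y V"
    and "open_set_condition D \<phi> V"
    and "is_attractor D \<phi> Y X"
    and "hausdorff_dim X > 0"
    and "z \<in> X"
    and "\<forall>n\<ge>1. \<theta> n \<ge> 0"
    and "comparable_on {1..} \<theta> (\<lambda>n. real n powr (- 1 / hausdorff_dim X))"
  shows "hausdorff_measure (hausdorff_dim X) (X - limsup_set D \<phi> X \<theta> z) = 0"
proof -
  have fin: "finite D" and oV: "open V" and YV: "Y \<subseteq> V"
    using assms(1) by (auto simp: conformal_ifs_def ifs_def)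
  have XY: "X \<subseteq> Y" and cX: "compact X" and Xeq: "X = (\<Union>i\<in>D. \<phi> i ` X)"
    using assms(3) by (auto simp: is_attractor_def)
  have XV: "X \<subseteq> V" using XY YV by blast
  obtain \<phi>' \<alpha> c where
    conf: "\<And>i. i \<in> D \<Longrightarrow> inj_on (\<phi> i) V \<and> contraction_on V (\<phi> i) \<and> conformal_on V (\<phi> i) (\<phi>' i) \<and>
      0 < (INF x\<in>V. norm (\<phi>' i x))"
    and \<alpha>: "0 < \<alpha>" and c: "0 < c"
    and hold: "\<And>i x y. i \<in> D \<Longrightarrow> x \<in> V \<Longrightarrow> y \<in> V \<Longrightarrow>
      \<bar>norm (\<phi>' i x) - norm (\<phi>' i y)\<bar> \<le> c * norm (x - y) powr \<alpha>"
    using assms(1) unfolding conformal_ifs_def by blast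
  \<comment> \<open>Common constants for the finitely many maps; the values \<open>1/2\<close> and \<open>1\<close> ensure \<open>0 < r\<close> and \<open>a \<le> 1\<close>.\<close>
  have "\<forall>i\<in>D. \<exists>r<1. r-lipschitz_on V (\<phi> i)" using conf by (auto simp: contraction_on_def)
  then obtain l where l: "\<And>i. i \<in> D \<Longrightarrow> l i < 1" "\<And>i. i \<in> D \<Longrightarrow> (l i)-lipschitz_on V (\<phi> i)" by metis
  define r where "r = Max (insert (1/2) (l ` D))"
  have r: "0 < r" "r < 1" using fin l(1) by (auto simp: r_def Max_gr_iff)
  have lip: "dist (\<phi> i x) (\<phi> i y) \<le> r * dist x y" if "i \<in> D" "x \<in> V" "y \<in> V" for i x y
  proof -
    have "dist (\<phi> i x) (\<phi> i y) \<le> l i * dist x y" using l(2) that by (auto simp: lipschitz_on_def)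
    also have "\<dots> \<le> r * dist x y" using fin that by (intro mult_right_mono) (auto simp: r_def)
    finally show ?thesis .
  qed
  define a where "a = Min (insert 1 ((\<lambda>i. INF x\<in>V. norm (\<phi>' i x)) ` D))"
  have a: "0 < a" "a \<le> 1" using fin conf by (auto simp: a_def)
  have a_le: "a \<le> norm (\<phi>' i x)" if "i \<in> D" "x \<in> V" for i x
  proof -
    have "a \<le> (INF x\<in>V. norm (\<phi>' i x))" using fin that by (simp add: a_def)
    also have "\<dots> \<le> norm (\<phi>' i x)" using that by (intro cINF_lower) (auto intro!: bdd_belowI2[of _ 0])
    finally show ?thesis .
  qed
  \<comment> \<open>The invariant set: a uniform neighbourhood of \<open>X\<close>, which the contractions preserve, together with the part of
    the open set inside a ball around \<open>z\<close> that is large enough to be invariant.\<close>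
  obtain e where e: "0 < e" "(\<Union>x\<in>X. ball x e) \<subseteq> V"
    using compact_subset_open_imp_ball_epsilon_subset[OF cX oV XV] by blast
  obtain U where U: "open U" "U \<noteq> {}" "U \<subseteq> V" "\<forall>i\<in>D. \<phi> i ` U \<subseteq> U"
    "\<forall>i\<in>D. \<forall>j\<in>D. i \<noteq> j \<longrightarrow> \<phi> i ` U \<inter> \<phi> j ` U = {}"
    using assms(2) unfolding open_set_condition_def by (elim exE conjE)
  obtain w where w: "w \<in> U" using U(2) by blast
  obtain B where B: "\<And>x y. x \<in> X \<Longrightarrow> y \<in> X \<Longrightarrow> dist x y \<le> B"
    using compact_imp_bounded[OF cX] unfolding bounded_two_points by blast
  have B0: "0 \<le> B" using B[OF assms(5) assms(5)] by simp
  have \<phi>X: "\<phi> i x \<in> X" if "i \<in> D" "x \<in> X" for i x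
    by (subst Xeq) (use that in blast)
  define R where "R = B / (1 - r) + dist z w + 1"
  have R: "r * R + B < R" "dist z w < R"
  proof -
    have "(1 - r) * R = B + (1 - r) * (dist z w + 1)" using r by (simp add: R_def field_simps)
    moreover have "0 < (1 - r) * (dist z w + 1)" using r by (simp add: add_nonneg_pos)
    ultimately show "r * R + B < R" by (simp add: algebra_simps)
    show "dist z w < R" using B0 r by (simp add: R_def add_nonneg_pos)
  qed
  define U0 where "U0 = U \<inter> ball z R"
  have U0_into: "\<phi> i x \<in> U0" if i: "i \<in> D" and x: "x \<in> U0" for i x
  proof -
    have "dist z (\<phi> i x) \<le> dist z (\<phi> i z) + dist (\<phi> i z) (\<phi> i x)" by (rule dist_triangle)
    also have "\<dots> \<le> B + r * dist z x"
      using x U(3) XV assms(5) i by (intro add_mono B \<phi>X lip) (auto simp: U0_def)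
    also have "\<dots> \<le> B + r * R" using x r by (intro add_left_mono mult_left_mono) (auto simp: U0_def)
    also have "\<dots> < R" using R(1) by simp
    finally show ?thesis using U(4) i x by (auto simp: U0_def)
  qed
  define T where "T = (\<Union>x\<in>X. ball x e) \<union> U0"
  have TV: "T \<subseteq> V" using e(2) U(3) by (auto simp: T_def U0_def)
  have T_into: "\<phi> i x \<in> T" if i: "i \<in> D" and x: "x \<in> T" for i x
  proof (cases "x \<in> U0")
    case True
    then show ?thesis using U0_into[OF i] by (simp add: T_def)
  next
    case False
    then obtain p where p: "p \<in> X" "dist p x < e" using x by (auto simp: T_def)
    have "dist (\<phi> i p) (\<phi> i x) \<le> r * dist p x" using i p(1) XV x TV by (intro lip) auto
    also have "\<dots> \<le> 1 * dist p x" using r by (intro mult_right_mono) auto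
    finally have "dist (\<phi> i p) (\<phi> i x) < e" using p(2) by simp
    then show ?thesis using \<phi>X[OF i p(1)] by (auto simp: T_def)
  qed
  have "T \<subseteq> ball z (B + e) \<union> ball z R"
  proof
    fix x assume "x \<in> T"
    then consider "x \<in> ball z R" | p where "p \<in> X" "dist p x < e" by (auto simp: T_def U0_def)
    then show "x \<in> ball z (B + e) \<union> ball z R"
    proof cases
      case 2
      then have "dist z x < B + e" using B[OF assms(5), of p] dist_triangle[of z x p] by simp
      then show ?thesis by simp
    qed simp
  qed
  then have "bounded T" by (rule bounded_subset[rotated]) simp
  then obtain \<Delta> where \<Delta>: "\<And>x y. x \<in> T \<Longrightarrow> y \<in> T \<Longrightarrow> dist x y \<le> \<Delta>" unfolding bounded_two_points by blast
  obtain y0 where y0: "y0 \<in> X" "z \<noteq> y0" using two_points_if_positive_dim[OF assms(4,5)] by blast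
  have "open U0" "w \<in> U0" using U(1) w R(2) by (auto simp: U0_def)
  then obtain \<eta> where \<eta>: "0 < \<eta>" "cball w \<eta> \<subseteq> U0" by (meson open_contains_cball)
  interpret osc_conformal_system D \<phi> \<phi>' T X r a c \<alpha> \<Delta> "e / 2" z y0 U0 w \<eta>
  proof
    show "\<phi> i ` U0 \<inter> \<phi> j ` U0 = {}" if "i \<in> D" "j \<in> D" "i \<noteq> j" for i j
      using U(5) that by (fastforce simp: U0_def)
    show "cball x (e / 2) \<subseteq> T" if "x \<in> X" for x
    proof -
      have "cball x (e / 2) \<subseteq> ball x e" using e(1) by (auto simp: subset_eq)
      then show ?thesis using that by (auto simp: T_def)
    qed
    show "0 < e / 2" using e(1) by simp
    show "U0 \<subseteq> T" by (simp add: T_def)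
    fix i x assume i: "i \<in> D"
    show "inj_on (\<phi> i) T" using conf[OF i] TV by (auto intro: inj_on_subset)
    assume x: "x \<in> T"
    then have xV: "x \<in> V" using TV by blast
    show "(\<phi> i has_derivative blinfun_apply (\<phi>' i x)) (at x)"
      using conf[OF i] xV by (simp add: conformal_on_def)
    show "norm (blinfun_apply (\<phi>' i x) v) = norm (\<phi>' i x) * norm v" for v
      using conf[OF i] xV by (simp add: conformal_on_def)
    show "a \<le> norm (\<phi>' i x)" by (rule a_le[OF i xV])
    fix y assume "y \<in> T"
    then have yV: "y \<in> V" using TV by blast
    show "dist (\<phi> i x) (\<phi> i y) \<le> r * dist x y" by (rule lip[OF i xV yV])
    show "\<bar>norm (\<phi>' i x) - norm (\<phi>' i y)\<bar> \<le> c * norm (x - y) powr \<alpha>" by (rule hold[OF i xV yV])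
  qed (fact fin r a \<alpha> c T_into U0_into \<Delta> cX Xeq assms(5) y0 \<eta>)+
  obtain C where C: "0 < C" "\<And>n. 1 \<le> n \<Longrightarrow> real n powr (- 1 / hausdorff_dim X) \<le> C * \<theta> n"
    using assms(7) by (auto simp: comparable_on_def)
  show ?thesis
  proof (rule limsup_set_full_measure[OF assms(4,5) C(1)])
    fix n :: nat assume "1 \<le> n"
    then show "inverse C * real n powr (- 1 / hausdorff_dim X) \<le> \<theta> n"
      using C(2)[of n] C(1) by (simp add: field_simps)
  qed
qed

end
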